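(* Let $c>0$ and $\gamma\in\mathbb R\setminus\{0\}$. Let $n\to\infty$ with $k=k(n)\to\infty$, $\frac kn\to c$, and let $q=q(n)=1-\frac{\gamma}{n}\to1$. Put $N=n+k-1$ and consider the correlation kernels $$\mathbf K_n(a,b)=\sqrt{W(a)W(b)}\sum_{l=0}^{n-1}\tilde K^q_l(a)\,\tilde K^q_l(b),\qquad a,b\in\{0,1,\dots,N\},$$ where $\tilde K^q_l(x)=\tilde K^q_l(q^{-x};p,N;q)$ are the normalized $q$-Krawtchouk polynomials, in one of the following two cases: (A) (the kernel of the measure $\mu_{n,k}(\lambda|q)$) $p=q^{1-2n}$ and $W(a)=q^{\binom a2+a(n-k)}\genfrac{[}{]}{0pt}{}{n+k-1}{a}_q$; (B) (the kernel of the measure $\mu_{n,k}(\lambda|q,q^{-1})$) $p=q^{2-2n-k}$ and $W(a)=q^{\binom a2+a(n-1)}\genfrac{[}{]}{0pt}{}{n+k-1}{a}_q$. Let $t\in(0,c+1)$ and integers $u,v$ be fixed. Then the kernels converge to the discrete sine kernel: $$\lim_{n\to\infty}\mathbf K_n(nt+u,nt+v)=\mathbf K^{sine}_\varphi(u,v)=\frac{\sin(\varphi(u-v))}{\pi(u-v)},$$ where in case (A) $$\varphi=\arccos\left(\mathrm{sgn}(-\gamma)\,\frac{e^{\gamma-\frac{\gamma t}2}}{2}\,\frac{1-e^{\gamma(c-1)}}{\sqrt{(1-e^{\gamma t})(1-e^{\gamma(c+1-t)})}}\right),$$ and in case (B) $$\varphi=\arccos\left(\mathrm{sgn}(-\gamma)\,\frac{e^{\frac\gamma2(t-c)}}{2}\,\frac{1-e^{\gamma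 c}-e^{\gamma(c-t)}+e^{\gamma(c+1-t)}}{\sqrt{(1-e^{\gamma t})(1-e^{\gamma(c+1-t)})}}\right).$$ Here $t$ is such that the argument of $\arccos$ lies in $[-1,1]$ (so that $\varphi$ is defined), $nt$ is understood as its integer part when it is not an integer, and for $u=v$ the right-hand side is understood as $\varphi/\pi$.
   Context: $q$-numbers: $[m]_q=\frac{1-q^m}{1-q}$, $[m]_q!=\prod_{i=1}^m[i]_q$, $\genfrac{[}{]}{0pt}{}{N}{i}_q=\frac{[N]_q!}{[i]_q!\,[N-i]_q!}$. Normalized $q$-Krawtchouk polynomials: for $q>0$, $q\ne1$, $p>0$ and a positive integer $N$, $\tilde K^q_j(q^{-x};p,N;q)$, $0\le j\le N$, is a polynomial of degree $j$ in the variable $q^{-x}$, and these satisfy $$\sum_{i=0}^{N}\genfrac{[}{]}{0pt}{}{N}{i}_q p^{-i}q^{\binom i2-iN}\,\tilde K^q_j(q^{-i};p,N;q)\,\tilde K^q_l(q^{-i};p,N;q)=\delta_{jl}$$ (this determines them up to sign). The measures named in (A) and (B) are the probability measures on Young diagrams $\lambda$ in the $n\times k$ rectangle given by $\mu_{n,k}(\lambda|q)=\frac{s_\lambda(1,q,\dots,q^{n-1})\,s_{\bar\lambda'}(1,q,\dots,q^{k-1})}{\prod_{i=1}^n\prod_{j=1}^k(q^{i-1}+q^{j-1})}$ and $\mu_{n,k}(\lambda|q,q^{-1})=\frac{s_\lambda(1,q,\dots,q^{n-1})\,s_{\bar\lambda'}(1,q^{-1},\dots,q^{1-k})}{\prod_{i=1}^n\prod_{j=1}^k(q^{i-1}+q^{1-j})}$,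 where $s$ denotes Schur polynomials and $\bar\lambda'$ is the conjugate of the complement of $\lambda$ in the rectangle; under $a_i=\lambda_i+n-i$ they are determinantal point processes on $\{0,\dots,N\}$ with the kernels $\mathbf K_n$ above. *)

theory Defs
  imports "HOL-Analysis.Analysis" "HOL-Computational_Algebra.Polynomial"
begin

definition q_number :: "real \<Rightarrow> nat \<Rightarrow> real" where
  "q_number q m = (1 - q ^ m) / (1 - q)"

definition q_fact :: "real \<Rightarrow> nat \<Rightarrow> real" where
  "q_fact q m = (\<Prod>i=1..m. q_number q i)"

(* Only meaningful for i \<le> N, because N - i is truncated subtraction. *)
definition q_binomial :: "real \<Rightarrow> nat \<Rightarrow> nat \<Rightarrow> real" where
  "q_binomial q N i = q_fact q N / (q_fact q i * q_fact q (N - i))"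

(* P j is the degree-j polynomial in the variable q^(-x), so its value at the node x = i is
   poly (P j) (q powi - int i). The condition determines each P j, j \<le> N, up to sign;
   P j for j > N is unconstrained. *)
definition normalized_q_Krawtchouk ::
    "real \<Rightarrow> real \<Rightarrow> nat \<Rightarrow> (nat \<Rightarrow> real poly) \<Rightarrow> bool" where
  "normalized_q_Krawtchouk q p N P \<longleftrightarrow>
     (\<forall>j\<le>N. degree (P j) = j) \<and>
     (\<forall>j\<le>N. \<forall>l\<le>N.
        (\<Sum>i=0..N. q_binomial q N i * p powi (- int i) * q powi (int (i choose 2) - int i * int N)
                   * poly (P j) (q powi (- int i)) * poly (P l) (q powi (- int i)))
        = (if j = l then 1 else 0))"

definition q_Krawtchouk_kernel ::
    "real \<Rightarrow> (nat \<Rightarrow> real poly) \<Rightarrow> (nat \<Rightarrow> real) \<Rightarrow> nat \<Rightarrow> nat \<Rightarrow> nat \<Rightarrow> real" where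
  "q_Krawtchouk_kernel q P W n a b =
     sqrt (W a * W b) * (\<Sum>l<n. poly (P l) (q powi (- int a)) * poly (P l) (q powi (- int b)))"

definition p_A :: "real \<Rightarrow> nat \<Rightarrow> nat \<Rightarrow> real" where
  "p_A q n k = q powi (1 - 2 * int n)"

definition W_A :: "real \<Rightarrow> nat \<Rightarrow> nat \<Rightarrow> nat \<Rightarrow> real" where
  "W_A q n k a = q powi (int (a choose 2) + int a * (int n - int k)) * q_binomial q (n + k - 1) a"

definition p_B :: "real \<Rightarrow> nat \<Rightarrow> nat \<Rightarrow> real" where
  "p_B q n k = q powi (2 - 2 * int n - int k)"

definition W_B :: "real \<Rightarrow> nat \<Rightarrow> nat \<Rightarrow> nat \<Rightarrow> real" where
  "W_B q n k a = q powi (int (a choose 2) + int a * (int n - 1)) * q_binomial q (n + k - 1) a"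

definition cos_phi_A :: "real \<Rightarrow> real \<Rightarrow> real \<Rightarrow> real" where
  "cos_phi_A \<gamma> c t =
     sgn (- \<gamma>) * (exp (\<gamma> - \<gamma> * t / 2) / 2)
       * ((1 - exp (\<gamma> * (c - 1)))
          / sqrt ((1 - exp (\<gamma> * t)) * (1 - exp (\<gamma> * (c + 1 - t)))))"

definition cos_phi_B :: "real \<Rightarrow> real \<Rightarrow> real \<Rightarrow> real" where
  "cos_phi_B \<gamma> c t =
     sgn (- \<gamma>) * (exp (\<gamma> / 2 * (t - c)) / 2)
       * ((1 - exp (\<gamma> * c) - exp (\<gamma> * (c - t)) + exp (\<gamma> * (c + 1 - t)))
          / sqrt ((1 - exp (\<gamma> * t)) * (1 - exp (\<gamma> * (c + 1 - t)))))"

definition discrete_sine_kernel :: "real \<Rightarrow> int \<Rightarrow> int \<Rightarrow> real" where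
  "discrete_sine_kernel \<phi> u v =
     (if u = v then \<phi> / pi
      else sin (\<phi> * real_of_int (u - v)) / (pi * real_of_int (u - v)))"

lemma q_number_pos:
  assumes "0 < q" "q \<noteq> 1" "1 \<le> m"
  shows "0 < q_number q m"
proof (cases "q < 1")
  case True
  then have "q ^ m < 1" using assms by (simp add: power_less_one_iff)
  with True show ?thesis by (simp add: q_number_def)
next
  case False
  then have "1 < q" using assms by simp
  then have "1 < q ^ m" using assms by (simp add: one_less_power)
  with \<open>1 < q\<close> show ?thesis by (simp add: q_number_def divide_neg_neg)
qed

lemma q_binomial_pos:
  assumes "0 < q" "q \<noteq> 1"
  shows "0 < q_binomial q N i"
  unfolding q_binomial_def q_fact_def
  by (intro divide_pos_pos mult_pos_pos prod_pos) (auto intro!: q_number_pos assms)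

lemma orthonormal_polys_exist:
  fixes w x :: "nat \<Rightarrow> real"
  assumes w: "\<And>i. i \<le> N \<Longrightarrow> 0 < w i" and x: "inj_on x {..N}" and "m \<le> Suc N"
  shows "\<exists>P. (\<forall>j<m. degree (P j) = j) \<and>
    (\<forall>j<m. \<forall>l<m. (\<Sum>i=0..N. w i * poly (P j) (x i) * poly (P l) (x i)) = (if j = l then 1 else 0))"
  using \<open>m \<le> Suc N\<close>
proof (induction m)
  case 0
  then show ?case by simp
next
  case (Suc m)
  define ip where "ip f g = (\<Sum>i=0..N. w i * poly f (x i) * poly g (x i))" for f g
  from Suc obtain P where deg: "\<And>j. j < m \<Longrightarrow> degree (P j) = j"
    and orth: "\<And>j l. j < m \<Longrightarrow> l < m \<Longrightarrow> ip (P j) (P l) = (if j = l then 1 else 0)"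
    unfolding ip_def by auto
  have ip_diff: "ip (f - g) h = ip f h - ip g h" for f g h
    by (simp add: ip_def algebra_simps sum_subtractf)
  have ip_smult: "ip (smult a f) h = a * ip f h" for a f h
    by (simp add: ip_def sum_distrib_left algebra_simps)
  have ip_sum: "ip (\<Sum>j\<in>A. F j) h = (\<Sum>j\<in>A. ip (F j) h)" for A h and F :: "nat \<Rightarrow> real poly"
    unfolding ip_def by (subst sum.swap) (simp add: poly_sum sum_distrib_left sum_distrib_right)
  have ip_sym: "ip f g = ip g f" for f g
    by (simp add: ip_def algebra_simps)
  define S where "S = (\<Sum>j<m. smult (ip (monom 1 m) (P j)) (P j))"
  define R where "R = monom 1 m - S"
  have coeffS: "coeff S r = 0" if "m \<le> r" for r
    unfolding S_def coeff_sum
    by (rule sum.neutral) (use deg that in \<open>auto intro!: coeff_eq_0\<close>)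
  have "coeff R m = 1" using coeffS by (simp add: R_def)
  moreover have "degree R \<le> m"
    by (rule degree_le) (use coeffS in \<open>auto simp: R_def\<close>)
  ultimately have degR: "degree R = m"
    by (metis le_degree order_antisym zero_neq_one)
  have "R \<noteq> 0" using \<open>coeff R m = 1\<close> by auto
  have R_orth: "ip R (P l) = 0" if "l < m" for l
  proof -
    have "ip S (P l) = (\<Sum>j<m. ip (monom 1 m) (P j) * (if j = l then 1 else 0))"
      unfolding S_def ip_sum ip_smult by (rule sum.cong) (use orth that in auto)
    also have "\<dots> = ip (monom 1 m) (P l)"
      using that by (simp add: if_distrib[of "(*) _"] cong: if_cong)
    finally show ?thesis by (simp add: R_def ip_diff)
  qed
  have R_pos: "0 < ip R R"
  proof -
    have "\<exists>i\<le>N. poly R (x i) \<noteq> 0"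
    proof (rule ccontr)
      assume "\<not> ?thesis"
      then have sub: "x ` {..N} \<subseteq> {z. poly R z = 0}" by auto
      have "card (x ` {..N}) \<le> card {z. poly R z = 0}"
        by (rule card_mono[OF poly_roots_finite[OF \<open>R \<noteq> 0\<close>] sub])
      also have "\<dots> \<le> m" using card_poly_roots_bound[OF \<open>R \<noteq> 0\<close>] degR by simp
      finally show False using card_image[OF x] Suc.prems by simp
    qed
    then obtain i where i: "i \<le> N" "poly R (x i) \<noteq> 0" by blast
    show ?thesis unfolding ip_def
    proof (rule sum_pos2[of _ i])
      show "0 < w i * poly R (x i) * poly R (x i)"
        using w[OF i(1)] i(2) by (auto simp: mult.assoc zero_less_mult_iff)
    qed (use i w in \<open>auto simp: mult.assoc less_imp_le intro!: mult_nonneg_nonneg\<close>)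
  qed
  define Q where "Q = P(m := smult (1 / sqrt (ip R R)) R)"
  have "degree (Q j) = j" if "j < Suc m" for j
    using that deg degR R_pos by (auto simp: Q_def less_Suc_eq)
  moreover have "ip (Q j) (Q l) = (if j = l then 1 else 0)" if "j < Suc m" "l < Suc m" for j l
  proof -
    have R1: "ip (smult a R) (P l) = 0" if "l < m" for a l using that R_orth ip_smult by simp
    have R2: "ip (P l) (smult a R) = 0" if "l < m" for a l using that R1 ip_sym by simp
    have R3: "ip (smult a R) (smult a R) = a * a * ip R R" for a
      by (metis ip_smult ip_sym mult.assoc)
    show ?thesis
      using that R1 R2 R_pos orth by (auto simp: Q_def less_Suc_eq R3)
  qed
  ultimately show ?case unfolding ip_def by (intro exI[of _ Q]) auto
qed

lemma normalized_q_Krawtchouk_exists: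
  assumes "0 < q" "q \<noteq> 1" "0 < p"
  shows "\<exists>P. normalized_q_Krawtchouk q p N P"
proof -
  have "inj_on (\<lambda>i. q powi (- int i)) {..N}"
    using assms
    by (auto simp: inj_on_def power_int_minus power_inject_exp')
  from orthonormal_polys_exist[OF _ this order_refl,
      of "\<lambda>i. q_binomial q N i * p powi (- int i) * q powi (int (i choose 2) - int i * int N)"]
  show ?thesis
    using assms q_binomial_pos unfolding normalized_q_Krawtchouk_def
    by (simp add: less_Suc_eq_le)
qed

end

theory Submission
  imports Defs
begin

text \<open>
  The kernel \<open>K\<^sub>n(a,b)\<close> is the matrix of a spectral projection, and the sine kernel is the matrix of
  the corresponding spectral projection of the limiting operator.

  Put \<open>\<sigma> = sgn (q - 1)\<close>.  The Krawtchouk weight is the reversible measure of a birth-death chain on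
  \<open>{0..N}\<close> with birth rates \<open>\<sigma>(1 - q\<^sup>x\<^sup>-\<^sup>N)\<close> and death rates \<open>\<sigma>p(q\<^sup>x - 1)\<close>.  The generator of the chain maps
  polynomials of degree \<open>m\<close> in \<open>q\<^sup>-\<^sup>x\<close> to polynomials of degree at most \<open>m\<close> and multiplies the leading
  coefficient by \<open>\<nu>\<^sub>m = \<sigma>(q\<^sup>-\<^sup>m - 1 - p(q\<^sup>m - 1))\<close>.  Since it is also symmetric for the weight, every
  family of orthonormal polynomials consists of its eigenfunctions (\<open>generator_eigenfunction\<close>).
  Conjugating by the square root of the weight turns the generator into a Jacobi matrix \<open>J\<close> with
  orthonormal eigenvectors \<open>\<psi>\<^sub>j\<close> and eigenvalues \<open>\<nu>\<^sub>j\<close>.  The factor \<open>\<sigma>\<close> makes \<open>\<nu>\<^sub>j\<close> strictly decreasing in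
  \<open>j\<close> for \<open>q < 1\<close> as well as for \<open>q > 1\<close>, so summation over \<open>j < n\<close> is summation over \<open>\<nu>\<^sub>j > \<nu>\<^sub>n\<close>, and
  \<open>K\<^sub>n\<close> is the matrix of the projection \<open>1(J > \<nu>\<^sub>n)\<close>.

  Near the site \<open>nt\<close> the entries of \<open>J\<close> converge to constants: \<open>\<beta>\<close> on the diagonal, \<open>\<alpha>\<close> beside it.  The
  limit is the Laurent operator with symbol \<open>\<beta> + 2\<alpha> cos \<theta>\<close>, and \<open>\<nu>\<^sub>n\<close> converges to some \<open>\<rho>\<close>.  An entry of a
  power of \<open>J\<close> involves only finitely many entries of \<open>J\<close> around it, so the entries of \<open>J\<^sup>m\<close> converge.
  All eigenvalues stay in a bounded interval, so Weierstrass approximation extends this to \<open>f(J)\<close> for continuous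
  \<open>f\<close>.  The spectral measures of the limit have no atoms, so it extends further to the discontinuous
  function \<open>1(\<cdot> > \<nu>\<^sub>n)\<close> (\<open>spectral_projection_limit\<close>).  The limit entry is
  \<open>(1/\<pi>) \<integral> cos((u-v)\<theta>) d\<theta>\<close> over \<open>{\<theta> \<in> [0,\<pi>]. \<beta> + 2\<alpha> cos \<theta> > \<rho>} = [0,\<phi>)\<close> with
  \<open>cos \<phi> = (\<rho> - \<beta>)/(2\<alpha>)\<close>, which is the discrete sine kernel.  Both cases have a \<open>p\<close> that converges to some
  \<open>e\<^sup>g\<close>, and differ only in the value of \<open>g\<close>.
\<close>

section \<open>Laurent operators with a cosine symbol\<close>

text \<open>The matrix entry at distance \<open>k\<close> from the diagonal of \<open>f(T)\<close>, where \<open>T\<close> is the operator on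
  \<open>\<ell>\<^sup>2(\<int>)\<close> with constant diagonal \<open>\<beta>\<close> and constant off-diagonals \<open>\<alpha>\<close>: the Fourier transform turns \<open>T\<close> into
  multiplication by \<open>\<beta> + 2\<alpha> cos \<theta>\<close>.  The symbol is even, so half of the circle and a cosine
  suffice.\<close>
definition Laurent_entry :: "real \<Rightarrow> real \<Rightarrow> (real \<Rightarrow> real) \<Rightarrow> int \<Rightarrow> real" where
  "Laurent_entry \<alpha> \<beta> f k =
     (1 / pi) * integral {0..pi} (\<lambda>\<theta>. f (\<beta> + 2 * \<alpha> * cos \<theta>) * cos (of_int k * \<theta>))"

lemma discrete_sine_kernel_eq_integral:
  assumes "0 \<le> \<phi>"
  shows "discrete_sine_kernel \<phi> u v = (1 / pi) * integral {0..\<phi>} (\<lambda>\<theta>. cos (of_int (u - v) * \<theta>))"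
proof (cases "u = v")
  case True
  then show ?thesis using assms by (simp add: discrete_sine_kernel_def)
next
  case False
  define k where "k = real_of_int (u - v)"
  have k: "k \<noteq> 0" using False by (simp add: k_def)
  have "((\<lambda>\<theta>. cos (k * \<theta>)) has_integral (sin (k * \<phi>) / k - sin (k * 0) / k)) {0..\<phi>}"
    using k by (intro fundamental_theorem_of_calculus assms)
      (auto intro!: derivative_eq_intros simp: has_real_derivative_iff_has_vector_derivative[symmetric])
  then have "integral {0..\<phi>} (\<lambda>\<theta>. cos (k * \<theta>)) = sin (k * \<phi>) / k"
    by (simp add: integral_unique)
  then show ?thesis
    unfolding discrete_sine_kernel_def k_def[symmetric] using False k by (simp add: mult.commute)
qed

lemma Laurent_integrand_continuous:
  fixes S :: "real set"
  assumes "continuous_on UNIV f"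
  shows "continuous_on S (\<lambda>\<theta>. f (\<beta> + 2 * \<alpha> * cos \<theta>) * cos (of_int k * \<theta>))"
  by (intro continuous_intros continuous_on_compose2[OF assms]) auto

lemma Laurent_integrand_integrable:
  assumes "continuous_on UNIV f"
  shows "(\<lambda>\<theta>. f (\<beta> + 2 * \<alpha> * cos \<theta>) * cos (of_int k * \<theta>)) integrable_on {0..pi}"
  by (intro integrable_continuous_interval Laurent_integrand_continuous assms)

lemma Laurent_entry_has_integral:
  assumes "continuous_on UNIV f"
  shows "((\<lambda>\<theta>. f (\<beta> + 2 * \<alpha> * cos \<theta>) * cos (of_int k * \<theta>))
      has_integral pi * Laurent_entry \<alpha> \<beta> f k) {0..pi}"
  using integrable_integral[OF Laurent_integrand_integrable[OF assms]] by (simp add: Laurent_entry_def)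

lemma Laurent_entry_one: "Laurent_entry \<alpha> \<beta> (\<lambda>_. 1) (u - v) = of_bool (u = v)"
proof -
  have "Laurent_entry \<alpha> \<beta> (\<lambda>_. 1) (u - v) = discrete_sine_kernel pi u v"
    by (simp add: Laurent_entry_def discrete_sine_kernel_eq_integral)
  also have "\<dots> = of_bool (u = v)"
    using sin_npi_int[of "u - v"] by (auto simp: discrete_sine_kernel_def mult.commute)
  finally show ?thesis .
qed

text \<open>The identity \<open>T f(T) = \<alpha> S f(T) + \<beta> f(T) + \<alpha> S\<^sup>-\<^sup>1 f(T)\<close> with the shift \<open>S\<close>, entry by entry; it rests on
  \<open>cos((k+1)\<theta>) + cos((k-1)\<theta>) = 2 cos \<theta> cos(k\<theta>)\<close>.\<close>
lemma Laurent_entry_mult_spectral_variable: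
  assumes f: "continuous_on UNIV f"
  shows "Laurent_entry \<alpha> \<beta> (\<lambda>x. x * f x) k
       = \<alpha> * Laurent_entry \<alpha> \<beta> f (k + 1) + \<beta> * Laurent_entry \<alpha> \<beta> f k + \<alpha> * Laurent_entry \<alpha> \<beta> f (k - 1)"
proof -
  have trig: "cos (of_int (k + 1) * \<theta>) + cos (of_int (k - 1) * \<theta>) = 2 * cos \<theta> * cos (of_int k * \<theta>)" for \<theta> :: real
    by (simp add: ring_distribs cos_add cos_diff)
  have "integral {0..pi} (\<lambda>\<theta>. (\<beta> + 2 * \<alpha> * cos \<theta>) * f (\<beta> + 2 * \<alpha> * cos \<theta>) * cos (of_int k * \<theta>))
      = integral {0..pi} (\<lambda>\<theta>. \<alpha> * (f (\<beta> + 2 * \<alpha> * cos \<theta>) * cos (of_int (k + 1) * \<theta>))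
          + \<beta> * (f (\<beta> + 2 * \<alpha> * cos \<theta>) * cos (of_int k * \<theta>))
          + \<alpha> * (f (\<beta> + 2 * \<alpha> * cos \<theta>) * cos (of_int (k - 1) * \<theta>)))"
  proof (intro integral_cong)
    fix \<theta>
    let ?f = "f (\<beta> + 2 * \<alpha> * cos \<theta>)"
    have "\<alpha> * (?f * cos (of_int (k + 1) * \<theta>)) + \<beta> * (?f * cos (of_int k * \<theta>))
          + \<alpha> * (?f * cos (of_int (k - 1) * \<theta>))
        = \<alpha> * ?f * (cos (of_int (k + 1) * \<theta>) + cos (of_int (k - 1) * \<theta>)) + \<beta> * (?f * cos (of_int k * \<theta>))"
      by (simp only: algebra_simps)
    then show "(\<beta> + 2 * \<alpha> * cos \<theta>) * ?f * cos (of_int k * \<theta>)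
        = \<alpha> * (?f * cos (of_int (k + 1) * \<theta>)) + \<beta> * (?f * cos (of_int k * \<theta>))
          + \<alpha> * (?f * cos (of_int (k - 1) * \<theta>))"
      unfolding trig by (simp only: algebra_simps)
  qed
  also have "\<dots> = \<alpha> * (pi * Laurent_entry \<alpha> \<beta> f (k + 1)) + \<beta> * (pi * Laurent_entry \<alpha> \<beta> f k)
          + \<alpha> * (pi * Laurent_entry \<alpha> \<beta> f (k - 1))"
    by (intro integral_unique has_integral_add has_integral_mult_right Laurent_entry_has_integral f)
  finally show ?thesis
    by (simp add: Laurent_entry_def[of _ _ "\<lambda>x. x * f x"] field_simps)
qed

lemma Laurent_entry_diff_bound:
  assumes f: "continuous_on UNIV f" and g: "continuous_on UNIV g" and h: "continuous_on UNIV h"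
    and le: "\<And>\<theta>. \<bar>f (\<beta> + 2 * \<alpha> * cos \<theta>) - g (\<beta> + 2 * \<alpha> * cos \<theta>)\<bar> \<le> h (\<beta> + 2 * \<alpha> * cos \<theta>)"
  shows "\<bar>Laurent_entry \<alpha> \<beta> f k - Laurent_entry \<alpha> \<beta> g k\<bar> \<le> Laurent_entry \<alpha> \<beta> h 0"
proof -
  let ?y = "\<lambda>\<theta>. \<beta> + 2 * \<alpha> * cos \<theta>"
  let ?D = "\<lambda>\<theta>. f (?y \<theta>) * cos (of_int k * \<theta>) - g (?y \<theta>) * cos (of_int k * \<theta>)"
  have "norm (integral {0..pi} ?D) \<le> integral {0..pi} (\<lambda>\<theta>. h (?y \<theta>) * cos (of_int 0 * \<theta>))"
  proof (rule integral_norm_bound_integral)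
    show "?D integrable_on {0..pi}"
      by (intro integrable_diff Laurent_integrand_integrable f g)
    show "(\<lambda>\<theta>. h (?y \<theta>) * cos (of_int 0 * \<theta>)) integrable_on {0..pi}"
      by (intro Laurent_integrand_integrable h)
    fix \<theta>
    have "\<bar>f (?y \<theta>) - g (?y \<theta>)\<bar> * \<bar>cos (of_int k * \<theta>)\<bar> \<le> h (?y \<theta>) * 1"
      using le[of \<theta>] by (intro mult_mono) auto
    then show "norm (?D \<theta>) \<le> h (?y \<theta>) * cos (of_int 0 * \<theta>)"
      by (simp add: abs_mult[symmetric] left_diff_distrib)
  qed
  also have "integral {0..pi} ?D = pi * (Laurent_entry \<alpha> \<beta> f k - Laurent_entry \<alpha> \<beta> g k)"
    by (subst integral_diff; (intro Laurent_integrand_integrable f g)?)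
      (simp add: Laurent_entry_def right_diff_distrib)
  also have "integral {0..pi} (\<lambda>\<theta>. h (?y \<theta>) * cos (of_int 0 * \<theta>)) = pi * Laurent_entry \<alpha> \<beta> h 0"
    by (simp add: Laurent_entry_def)
  finally show ?thesis
    by (simp add: abs_mult)
qed

lemma Laurent_entry_sum:
  assumes "finite I" "\<And>i. i \<in> I \<Longrightarrow> continuous_on UNIV (f i)"
  shows "Laurent_entry \<alpha> \<beta> (\<lambda>x. \<Sum>i\<in>I. c i * f i x) k = (\<Sum>i\<in>I. c i * Laurent_entry \<alpha> \<beta> (f i) k)"
proof -
  have "((\<lambda>\<theta>. \<Sum>i\<in>I. c i * (f i (\<beta> + 2 * \<alpha> * cos \<theta>) * cos (of_int k * \<theta>)))
      has_integral (\<Sum>i\<in>I. c i * (pi * Laurent_entry \<alpha> \<beta> (f i) k))) {0..pi}"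
    by (intro has_integral_sum assms(1) has_integral_mult_right Laurent_entry_has_integral assms(2))
  then have "integral {0..pi} (\<lambda>\<theta>. (\<Sum>i\<in>I. c i * f i (\<beta> + 2 * \<alpha> * cos \<theta>)) * cos (of_int k * \<theta>))
      = (\<Sum>i\<in>I. c i * (pi * Laurent_entry \<alpha> \<beta> (f i) k))"
    by (simp add: sum_distrib_right mult.assoc integral_unique)
  then show ?thesis
    by (simp add: Laurent_entry_def[of _ _ "\<lambda>x. \<Sum>i\<in>I. c i * f i x"] sum_distrib_left mult_ac)
qed

section \<open>Continuous approximation of a spectral cut-off\<close>

text \<open>The ramp is a continuous stand-in for the step at \<open>\<rho>\<close>.  The tent dominates the error of this
  replacement, even if the step is moved by at most \<open>\<delta>\<close>, which absorbs a threshold that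
  only converges to \<open>\<rho>\<close>.\<close>
definition ramp :: "real \<Rightarrow> real \<Rightarrow> real \<Rightarrow> real" where
  "ramp \<rho> \<delta> x = max 0 (min 1 ((x - \<rho>) / \<delta>))"

definition tent :: "real \<Rightarrow> real \<Rightarrow> real \<Rightarrow> real" where
  "tent \<rho> \<delta> x = max 0 (2 - \<bar>x - \<rho>\<bar> / \<delta>)"

lemma continuous_ramp: "continuous_on S (ramp \<rho> \<delta>)"
  unfolding ramp_def [abs_def] divide_inverse by (intro continuous_intros)

lemma continuous_tent: "continuous_on S (tent \<rho> \<delta>)"
  unfolding tent_def [abs_def] divide_inverse by (intro continuous_intros)

lemma step_minus_ramp_le_tent:
  assumes \<delta>: "0 < \<delta>" and r: "\<bar>r - \<rho>\<bar> \<le> \<delta>"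
  shows "\<bar>of_bool (r < x) - ramp \<rho> \<delta> x\<bar> \<le> tent \<rho> \<delta> x"
proof -
  consider "\<bar>x - \<rho>\<bar> \<le> \<delta>" | "x - \<rho> > \<delta>" | "x - \<rho> < - \<delta>" by linarith
  then show ?thesis
  proof cases
    case 1
    then have "\<bar>x - \<rho>\<bar> / \<delta> \<le> 1" using \<delta> by simp
    then have "1 \<le> tent \<rho> \<delta> x" by (simp add: tent_def)
    moreover have "\<bar>of_bool (r < x) - ramp \<rho> \<delta> x\<bar> \<le> 1" by (auto simp: ramp_def)
    ultimately show ?thesis by linarith
  next
    case 2
    then have "1 \<le> (x - \<rho>) / \<delta>" using \<delta> by simp
    then have "ramp \<rho> \<delta> x = 1" by (simp add: ramp_def)
    moreover have "r < x" using 2 r by linarith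
    ultimately show ?thesis by (simp add: tent_def)
  next
    case 3
    then have "(x - \<rho>) / \<delta> \<le> 0" using \<delta> by (simp add: divide_nonpos_pos)
    then have "ramp \<rho> \<delta> x = 0" by (simp add: ramp_def)
    moreover have "\<not> r < x" using 3 r by linarith
    ultimately show ?thesis by (simp add: tent_def)
  qed
qed

text \<open>The spectral measure of the limit operator has no atom: as the tent shrinks to the point \<open>\<rho>\<close>,
  its integrand survives at a single angle only.\<close>
lemma Laurent_entry_tent_tendsto_0:
  assumes \<alpha>: "0 < \<alpha>"
  shows "(\<lambda>m. Laurent_entry \<alpha> \<beta> (tent \<rho> (1 / real (Suc m))) 0) \<longlonglongrightarrow> 0"
proof -
  define F where "F m \<theta> = tent \<rho> (1 / real (Suc m)) (\<beta> + 2 * \<alpha> * cos \<theta>) * cos (of_int 0 * \<theta>)" for m \<theta>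
  define g :: "real \<Rightarrow> real" where "g \<theta> = (if \<beta> + 2 * \<alpha> * cos \<theta> = \<rho> then 2 else 0)" for \<theta>
  have "(\<lambda>m. integral {0..pi} (F m)) \<longlonglongrightarrow> integral {0..pi} g"
  proof (rule dominated_convergence(2)[where h = "\<lambda>_. 2"])
    show "F m integrable_on {0..pi}" for m
      unfolding F_def by (intro Laurent_integrand_integrable continuous_tent)
    show "norm (F m \<theta>) \<le> 2" for m \<theta>
      by (simp add: F_def tent_def)
    show "(\<lambda>m. F m \<theta>) \<longlonglongrightarrow> g \<theta>" for \<theta>
    proof (cases "\<beta> + 2 * \<alpha> * cos \<theta> = \<rho>")
      case True
      then show ?thesis by (simp add: F_def g_def tent_def)
    next
      case False
      define d where "d = \<bar>\<beta> + 2 * \<alpha> * cos \<theta> - \<rho>\<bar>"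
      have d: "d > 0" using False by (simp add: d_def)
      obtain K :: nat where K: "2 / d < real K" using reals_Archimedean2 by blast
      have "F m \<theta> = 0" if "m \<ge> K" for m
      proof -
        have "2 / d \<le> real (Suc m)" using K that by simp
        then have "2 \<le> d * real (Suc m)" using d by (simp add: field_simps)
        then show ?thesis by (simp add: F_def tent_def d_def)
      qed
      then have "\<forall>\<^sub>F m in sequentially. F m \<theta> = g \<theta>"
        using False unfolding eventually_sequentially g_def by auto
      then show ?thesis by (rule tendsto_eventually)
    qed
  qed auto
  also have "integral {0..pi} g = integral {0..pi} (\<lambda>_. 0 :: real)"
  proof (rule integral_spike)
    show "negligible {arccos ((\<rho> - \<beta>) / (2 * \<alpha>))}" by simp
    fix \<theta> assume \<theta>: "\<theta> \<in> {0..pi} - {arccos ((\<rho> - \<beta>) / (2 * \<alpha>))}"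
    have "\<beta> + 2 * \<alpha> * cos \<theta> \<noteq> \<rho>"
    proof
      assume "\<beta> + 2 * \<alpha> * cos \<theta> = \<rho>"
      then have "cos \<theta> = (\<rho> - \<beta>) / (2 * \<alpha>)" using \<alpha> by (simp add: field_simps)
      then show False using \<theta> arccos_cos[of \<theta>] by simp
    qed
    then show "0 = g \<theta>" by (simp add: g_def)
  qed
  finally have "(\<lambda>m. (1 / pi) * integral {0..pi} (F m)) \<longlonglongrightarrow> (1 / pi) * integral {0..pi} (\<lambda>_. 0 :: real)"
    by (intro tendsto_intros)
  then show ?thesis unfolding Laurent_entry_def F_def by simp
qed

text \<open>The cosine decreases on \<open>[0,\<pi>]\<close>, so \<open>\<beta> + 2\<alpha> cos \<theta>\<close> exceeds \<open>\<rho>\<close> exactly on \<open>[0,\<phi>)\<close>, and the sine kernel is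
  the entry of the spectral projection beyond \<open>\<rho>\<close>.  Its distance to the entry for the ramp is then
  controlled by the tent.\<close>
lemma sine_kernel_minus_ramp_le_tent:
  assumes \<alpha>: "0 < \<alpha>" and C: "(\<rho> - \<beta>) / (2 * \<alpha>) \<in> {-1..1}" and \<delta>: "0 < \<delta>"
  shows "\<bar>discrete_sine_kernel (arccos ((\<rho> - \<beta>) / (2 * \<alpha>))) u v
      - Laurent_entry \<alpha> \<beta> (ramp \<rho> \<delta>) (u - v)\<bar> \<le> Laurent_entry \<alpha> \<beta> (tent \<rho> \<delta>) 0"
proof -
  define \<phi> where "\<phi> = arccos ((\<rho> - \<beta>) / (2 * \<alpha>))"
  define y where "y \<theta> = \<beta> + 2 * \<alpha> * cos \<theta>" for \<theta>
  define G where "G \<theta> = cos (of_int (u - v) * \<theta>)" for \<theta> :: real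
  have \<phi>: "0 \<le> \<phi>" "\<phi> \<le> pi" "cos \<phi> = (\<rho> - \<beta>) / (2 * \<alpha>)"
    using C by (simp_all add: \<phi>_def arccos_lbound arccos_ubound)
  have step: "\<rho> < y \<theta> \<longleftrightarrow> \<theta> < \<phi>" if "\<theta> \<in> {0..pi}" for \<theta>
  proof -
    have "\<rho> < y \<theta> \<longleftrightarrow> cos \<phi> < cos \<theta>"
      using \<alpha> by (simp add: \<phi>(3) y_def field_simps)
    also have "\<dots> \<longleftrightarrow> \<theta> < \<phi>"
      using that \<phi> by (intro cos_mono_less_eq) auto
    finally show ?thesis .
  qed
  have "(G has_integral integral {0..\<phi>} G) (cbox 0 \<phi>)"
    unfolding G_def cbox_interval
    by (intro integrable_integral integrable_continuous_interval continuous_intros)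
  then have "((\<lambda>\<theta>. if \<theta> \<in> cbox 0 \<phi> then G \<theta> else 0) has_integral integral {0..\<phi>} G) (cbox 0 pi)"
    using \<phi> by (intro has_integral_restrict_closed_subinterval) auto
  then have "((\<lambda>\<theta>. of_bool (\<rho> < y \<theta>) * G \<theta>) has_integral integral {0..\<phi>} G) (cbox 0 pi)"
    by (rule has_integral_spike[OF negligible_sing[of \<phi>], rotated]) (use step in auto)
  then have step_int: "((\<lambda>\<theta>. of_bool (\<rho> < y \<theta>) * G \<theta>) has_integral integral {0..\<phi>} G) {0..pi}"
    by simp
  have ramp_int: "(\<lambda>\<theta>. ramp \<rho> \<delta> (y \<theta>) * G \<theta>) integrable_on {0..pi}"
    unfolding y_def G_def by (intro Laurent_integrand_integrable continuous_ramp)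
  have "norm (integral {0..pi} (\<lambda>\<theta>. of_bool (\<rho> < y \<theta>) * G \<theta> - ramp \<rho> \<delta> (y \<theta>) * G \<theta>))
      \<le> integral {0..pi} (\<lambda>\<theta>. tent \<rho> \<delta> (y \<theta>) * cos (of_int 0 * \<theta>))"
  proof (rule integral_norm_bound_integral)
    show "(\<lambda>\<theta>. of_bool (\<rho> < y \<theta>) * G \<theta> - ramp \<rho> \<delta> (y \<theta>) * G \<theta>) integrable_on {0..pi}"
      using step_int ramp_int by (intro integrable_diff) auto
    show "(\<lambda>\<theta>. tent \<rho> \<delta> (y \<theta>) * cos (of_int 0 * \<theta>)) integrable_on {0..pi}"
      unfolding y_def by (intro Laurent_integrand_integrable continuous_tent)
    fix \<theta>
    have "\<bar>of_bool (\<rho> < y \<theta>) - ramp \<rho> \<delta> (y \<theta>)\<bar> * \<bar>G \<theta>\<bar> \<le> tent \<rho> \<delta> (y \<theta>) * 1"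
      using step_minus_ramp_le_tent[OF \<delta>, of \<rho> \<rho> "y \<theta>"] \<delta>
      by (intro mult_mono) (auto simp: G_def)
    then show "norm (of_bool (\<rho> < y \<theta>) * G \<theta> - ramp \<rho> \<delta> (y \<theta>) * G \<theta>)
        \<le> tent \<rho> \<delta> (y \<theta>) * cos (of_int 0 * \<theta>)"
      by (simp add: abs_mult[symmetric] left_diff_distrib)
  qed
  also have "integral {0..pi} (\<lambda>\<theta>. of_bool (\<rho> < y \<theta>) * G \<theta> - ramp \<rho> \<delta> (y \<theta>) * G \<theta>)
      = integral {0..\<phi>} G - integral {0..pi} (\<lambda>\<theta>. ramp \<rho> \<delta> (y \<theta>) * G \<theta>)"
    using step_int ramp_int by (subst integral_diff) (auto simp: integral_unique)
  also have "\<dots> = pi * (discrete_sine_kernel \<phi> u v - Laurent_entry \<alpha> \<beta> (ramp \<rho> \<delta>) (u - v))"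
    using discrete_sine_kernel_eq_integral[OF \<phi>(1), of u v]
    unfolding Laurent_entry_def y_def G_def by (simp add: right_diff_distrib)
  also have "integral {0..pi} (\<lambda>\<theta>. tent \<rho> \<delta> (y \<theta>) * cos (of_int 0 * \<theta>)) = pi * Laurent_entry \<alpha> \<beta> (tent \<rho> \<delta>) 0"
    by (simp add: Laurent_entry_def y_def)
  finally show ?thesis
    by (simp add: abs_mult \<phi>_def)
qed

section \<open>Jacobi matrices that converge locally to a Laurent operator\<close>

text \<open>A sequence of finite Jacobi matrices, seen through a moving window: \<open>\<psi> n j u\<close> is the value at the
  site \<open>u\<close>, relative to the window, of the \<open>j\<close>-th eigenvector of the \<open>n\<close>-th matrix, and \<open>\<nu> n j\<close> is its
  eigenvalue.  The matrix entries are controlled at each fixed relative site; distant sites act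
  only through completeness and the bound on the spectrum.\<close>
locale locally_Laurent_Jacobi =
  fixes N :: "nat \<Rightarrow> nat" and \<nu> :: "nat \<Rightarrow> nat \<Rightarrow> real" and \<psi> :: "nat \<Rightarrow> nat \<Rightarrow> int \<Rightarrow> real"
    and a b :: "nat \<Rightarrow> int \<Rightarrow> real" and \<alpha> \<beta> M :: real
  assumes complete: "\<And>u v. \<forall>\<^sub>F n in sequentially. (\<Sum>j\<le>N n. \<psi> n j u * \<psi> n j v) = of_bool (u = v)"
    and three_term: "\<And>u. \<forall>\<^sub>F n in sequentially. \<forall>j\<le>N n.
          \<nu> n j * \<psi> n j u = a n u * \<psi> n j (u + 1) + b n u * \<psi> n j u + a n (u - 1) * \<psi> n j (u - 1)"
    and bounded_spectrum: "\<forall>\<^sub>F n in sequentially. \<forall>j\<le>N n. \<bar>\<nu> n j\<bar> \<le> M"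
    and a_lim: "\<And>u. (\<lambda>n. a n u) \<longlonglongrightarrow> \<alpha>" and b_lim: "\<And>u. (\<lambda>n. b n u) \<longlonglongrightarrow> \<beta>"
    and \<alpha>_pos: "0 < \<alpha>"
begin

definition entry :: "(real \<Rightarrow> real) \<Rightarrow> nat \<Rightarrow> int \<Rightarrow> int \<Rightarrow> real" where
  "entry f n u v = (\<Sum>j\<le>N n. f (\<nu> n j) * \<psi> n j u * \<psi> n j v)"

text \<open>Replacing \<open>f\<close> by \<open>g\<close> costs at most the average of the two diagonal entries of a majorant of
  \<open>\<bar>f - g\<bar>\<close>, by the inequality of arithmetic and geometric means for each product \<open>\<psi>\<^sub>j(u) \<psi>\<^sub>j(v)\<close>.\<close>
lemma entry_diff_bound:
  assumes "\<And>j. j \<le> N n \<Longrightarrow> \<bar>f (\<nu> n j) - g (\<nu> n j)\<bar> \<le> h (\<nu> n j)"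
  shows "\<bar>entry f n u v - entry g n u v\<bar> \<le> (entry h n u u + entry h n v v) / 2"
proof -
  have term_le: "\<bar>(f (\<nu> n j) - g (\<nu> n j)) * \<psi> n j u * \<psi> n j v\<bar>
      \<le> (h (\<nu> n j) * \<psi> n j u * \<psi> n j u + h (\<nu> n j) * \<psi> n j v * \<psi> n j v) / 2"
    if "j \<le> N n" for j
  proof -
    have "0 \<le> (\<bar>\<psi> n j u\<bar> - \<bar>\<psi> n j v\<bar>)\<^sup>2" by simp
    then have *: "\<bar>\<psi> n j u\<bar> * \<bar>\<psi> n j v\<bar> \<le> (\<psi> n j u * \<psi> n j u + \<psi> n j v * \<psi> n j v) / 2"
      by (simp add: power2_eq_square algebra_simps)
    have "\<bar>f (\<nu> n j) - g (\<nu> n j)\<bar> * (\<bar>\<psi> n j u\<bar> * \<bar>\<psi> n j v\<bar>)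
        \<le> h (\<nu> n j) * ((\<psi> n j u * \<psi> n j u + \<psi> n j v * \<psi> n j v) / 2)"
      using assms[OF that] * by (intro mult_mono) (auto intro: order_trans[OF abs_ge_zero])
    then show ?thesis unfolding abs_mult by (simp add: distrib_left mult_ac)
  qed
  have "\<bar>entry f n u v - entry g n u v\<bar> = \<bar>\<Sum>j\<le>N n. (f (\<nu> n j) - g (\<nu> n j)) * \<psi> n j u * \<psi> n j v\<bar>"
    by (simp add: entry_def sum_subtractf[symmetric] left_diff_distrib)
  also have "\<dots> \<le> (\<Sum>j\<le>N n. \<bar>(f (\<nu> n j) - g (\<nu> n j)) * \<psi> n j u * \<psi> n j v\<bar>)"
    by (rule sum_abs)
  also have "\<dots> \<le> (\<Sum>j\<le>N n. (h (\<nu> n j) * \<psi> n j u * \<psi> n j u + h (\<nu> n j) * \<psi> n j v * \<psi> n j v) / 2)"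
    by (intro sum_mono term_le) simp
  also have "\<dots> = (entry h n u u + entry h n v v) / 2"
    by (simp add: entry_def sum.distrib sum_divide_distrib[symmetric])
  finally show ?thesis .
qed

text \<open>The three-term recurrence expresses the entries of \<open>J\<^sup>m\<^sup>+\<^sup>1\<close> by those of \<open>J\<^sup>m\<close> at the neighbouring sites,
  with coefficients that converge; the limits obey the same recursion.\<close>
lemma entry_power_limit:
  "(\<lambda>n. entry (\<lambda>x. x ^ m) n u v) \<longlonglongrightarrow> Laurent_entry \<alpha> \<beta> (\<lambda>x. x ^ m) (u - v)"
proof (induction m arbitrary: u)
  case 0
  have "\<forall>\<^sub>F n in sequentially. entry (\<lambda>x. x ^ 0) n u v = Laurent_entry \<alpha> \<beta> (\<lambda>x. x ^ 0) (u - v)"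
    using complete[of u v] by eventually_elim (simp add: entry_def Laurent_entry_one)
  then show ?case by (rule tendsto_eventually)
next
  case (Suc m)
  let ?E = "\<lambda>n u. entry (\<lambda>x. x ^ m) n u v"
  let ?L = "\<lambda>k. Laurent_entry \<alpha> \<beta> (\<lambda>x. x ^ m) k"
  have "(\<lambda>n. a n u * ?E n (u + 1) + b n u * ?E n u + a n (u - 1) * ?E n (u - 1))
      \<longlonglongrightarrow> \<alpha> * ?L (u + 1 - v) + \<beta> * ?L (u - v) + \<alpha> * ?L (u - 1 - v)"
    by (intro tendsto_intros a_lim b_lim Suc.IH)
  also have "\<alpha> * ?L (u + 1 - v) + \<beta> * ?L (u - v) + \<alpha> * ?L (u - 1 - v)
      = Laurent_entry \<alpha> \<beta> (\<lambda>x. x ^ Suc m) (u - v)"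
    using Laurent_entry_mult_spectral_variable[of "\<lambda>x. x ^ m" \<alpha> \<beta> "u - v"]
    by (simp add: continuous_intros algebra_simps)
  finally show ?case
  proof (rule Lim_transform_eventually)
    show "\<forall>\<^sub>F n in sequentially. a n u * ?E n (u + 1) + b n u * ?E n u + a n (u - 1) * ?E n (u - 1)
        = entry (\<lambda>x. x ^ Suc m) n u v"
      using three_term[of u]
    proof eventually_elim
      case (elim n)
      have "entry (\<lambda>x. x ^ Suc m) n u v = (\<Sum>j\<le>N n. \<nu> n j ^ m * (\<nu> n j * \<psi> n j u) * \<psi> n j v)"
        by (simp add: entry_def mult_ac)
      also have "\<dots> = (\<Sum>j\<le>N n. \<nu> n j ^ m * (a n u * \<psi> n j (u + 1) + b n u * \<psi> n j u
          + a n (u - 1) * \<psi> n j (u - 1)) * \<psi> n j v)"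
        using elim by (intro sum.cong refl) simp
      also have "\<dots> = a n u * ?E n (u + 1) + b n u * ?E n u + a n (u - 1) * ?E n (u - 1)"
        by (simp add: entry_def sum_distrib_left sum.distrib[symmetric] algebra_simps)
      finally show ?case ..
    qed
  qed
qed

lemma entry_continuous_limit:
  assumes f: "continuous_on UNIV f"
  shows "(\<lambda>n. entry f n u v) \<longlonglongrightarrow> Laurent_entry \<alpha> \<beta> f (u - v)"
proof (rule tendstoI)
  fix e :: real assume "0 < e"
  define e' where "e' = e / 3"
  have e': "0 < e'" using \<open>0 < e\<close> by (simp add: e'_def)
  \<comment> \<open>an interval that contains all eigenvalues as well as the range of the symbol\<close>
  define K where "K = {- (\<bar>M\<bar> + \<bar>\<beta>\<bar> + 2 * \<alpha>) .. \<bar>M\<bar> + \<bar>\<beta>\<bar> + 2 * \<alpha>}"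
  have symbol_K: "\<beta> + 2 * \<alpha> * cos \<theta> \<in> K" for \<theta>
  proof -
    have "\<bar>2 * \<alpha> * cos \<theta>\<bar> \<le> 2 * \<alpha>"
      using \<alpha>_pos mult_left_mono[OF abs_cos_le_one[of \<theta>], of "2 * \<alpha>"] by (simp add: abs_mult)
    then show ?thesis unfolding K_def by (simp add: abs_le_iff) linarith
  qed
  obtain g where "real_polynomial_function g" and gK: "\<And>x. x \<in> K \<Longrightarrow> \<bar>f x - g x\<bar> < e'"
    using Stone_Weierstrass_real_polynomial_function[of K f e'] e' continuous_on_subset[OF f]
    unfolding K_def by (metis compact_Icc subset_UNIV)
  then obtain c d where g: "g = (\<lambda>x. \<Sum>i\<le>d. c i * x ^ i)"
    unfolding real_polynomial_function_iff_sum by blast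
  have g_cont: "continuous_on UNIV g"
    unfolding g by (intro continuous_intros)
  have "entry g n u v = (\<Sum>i\<le>d. c i * entry (\<lambda>x. x ^ i) n u v)" for n
    unfolding entry_def g sum_distrib_left sum_distrib_right
    by (subst sum.swap) (simp add: mult.assoc)
  moreover have "Laurent_entry \<alpha> \<beta> g (u - v) = (\<Sum>i\<le>d. c i * Laurent_entry \<alpha> \<beta> (\<lambda>x. x ^ i) (u - v))"
    unfolding g by (intro Laurent_entry_sum) (auto intro!: continuous_intros)
  ultimately have "(\<lambda>n. entry g n u v) \<longlonglongrightarrow> Laurent_entry \<alpha> \<beta> g (u - v)"
    by (simp add: tendsto_intros entry_power_limit)
  from tendstoD[OF this e']
  have ev: "\<forall>\<^sub>F n in sequentially. \<bar>entry g n u v - Laurent_entry \<alpha> \<beta> g (u - v)\<bar> < e'"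
    by (simp add: dist_real_def)
  have "\<bar>Laurent_entry \<alpha> \<beta> f (u - v) - Laurent_entry \<alpha> \<beta> g (u - v)\<bar> \<le> Laurent_entry \<alpha> \<beta> (\<lambda>_. e') 0"
    using gK[OF symbol_K] by (intro Laurent_entry_diff_bound f g_cont) (auto intro: less_imp_le)
  also have "\<dots> = e'"
    by (simp add: Laurent_entry_def)
  finally have limit_close: "\<bar>Laurent_entry \<alpha> \<beta> f (u - v) - Laurent_entry \<alpha> \<beta> g (u - v)\<bar> \<le> e'" .
  show "\<forall>\<^sub>F n in sequentially. dist (entry f n u v) (Laurent_entry \<alpha> \<beta> f (u - v)) < e"
    using ev bounded_spectrum complete[of u u] complete[of v v]
  proof eventually_elim
    case (elim n)
    have const: "entry (\<lambda>_. e') n w w = e' * (\<Sum>j\<le>N n. \<psi> n j w * \<psi> n j w)" for w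
      by (simp add: entry_def sum_distrib_left mult.assoc)
    have "\<bar>entry f n u v - entry g n u v\<bar> \<le> (entry (\<lambda>_. e') n u u + entry (\<lambda>_. e') n v v) / 2"
    proof (rule entry_diff_bound)
      fix j assume "j \<le> N n"
      then have "\<nu> n j \<in> K"
        using elim(2) \<alpha>_pos by (force simp: K_def abs_le_iff)
      then show "\<bar>f (\<nu> n j) - g (\<nu> n j)\<bar> \<le> e'"
        using gK less_imp_le by blast
    qed
    also have "\<dots> = e'"
      unfolding const using elim by simp
    finally show ?case
      using limit_close elim(1) unfolding dist_real_def e'_def by linarith
  qed
qed

text \<open>The ramp has converging entries because it is continuous.  Both the finite projections and the
  sine kernel differ from it by at most diagonal entries of the tent, which are small in the limit.\<close>
theorem spectral_projection_limit:
  assumes r: "r \<longlonglongrightarrow> \<rho>" and C: "(\<rho> - \<beta>) / (2 * \<alpha>) \<in> {-1..1}"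
  shows "(\<lambda>n. \<Sum>j | j \<le> N n \<and> r n < \<nu> n j. \<psi> n j u * \<psi> n j v)
      \<longlonglongrightarrow> discrete_sine_kernel (arccos ((\<rho> - \<beta>) / (2 * \<alpha>))) u v"
proof (rule tendstoI)
  fix e :: real assume "0 < e"
  define e' where "e' = e / 4"
  have e': "0 < e'" using \<open>0 < e\<close> by (simp add: e'_def)
  let ?S = "discrete_sine_kernel (arccos ((\<rho> - \<beta>) / (2 * \<alpha>))) u v"
  obtain m where m: "\<bar>Laurent_entry \<alpha> \<beta> (tent \<rho> (1 / real (Suc m))) 0\<bar> < e'"
    using tendstoD[OF Laurent_entry_tent_tendsto_0[OF \<alpha>_pos, of \<beta> \<rho>] e']
    by (auto simp: dist_real_def eventually_sequentially)
  define \<delta> where "\<delta> = 1 / real (Suc m)"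
  have \<delta>: "0 < \<delta>" by (simp add: \<delta>_def)
  let ?R = "Laurent_entry \<alpha> \<beta> (ramp \<rho> \<delta>) (u - v)" and ?T = "Laurent_entry \<alpha> \<beta> (tent \<rho> \<delta>) 0"
  have T: "\<bar>?T\<bar> < e'" using m by (simp add: \<delta>_def)
  have SR: "\<bar>?S - ?R\<bar> \<le> ?T"
    by (rule sine_kernel_minus_ramp_le_tent[OF \<alpha>_pos C \<delta>])
  have tent_lim: "\<forall>\<^sub>F n in sequentially. \<bar>entry (tent \<rho> \<delta>) n w w - ?T\<bar> < e'" for w
    using tendstoD[OF entry_continuous_limit[OF continuous_tent, of \<rho> \<delta> w w] e'] by (simp add: dist_real_def)
  have ramp_lim: "\<forall>\<^sub>F n in sequentially. \<bar>entry (ramp \<rho> \<delta>) n u v - ?R\<bar> < e'"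
    using tendstoD[OF entry_continuous_limit[OF continuous_ramp, of \<rho> \<delta> u v] e'] by (simp add: dist_real_def)
  have r_close: "\<forall>\<^sub>F n in sequentially. \<bar>r n - \<rho>\<bar> < \<delta>"
    using tendstoD[OF r \<delta>] by (simp add: dist_real_def)
  show "\<forall>\<^sub>F n in sequentially. dist (\<Sum>j | j \<le> N n \<and> r n < \<nu> n j. \<psi> n j u * \<psi> n j v) ?S < e"
    using tent_lim[of u] tent_lim[of v] ramp_lim r_close
  proof eventually_elim
    case (elim n)
    define X where "X = (\<Sum>j | j \<le> N n \<and> r n < \<nu> n j. \<psi> n j u * \<psi> n j v)"
    have X: "X = entry (\<lambda>x. of_bool (r n < x)) n u v"
      unfolding X_def entry_def by (rule sum.mono_neutral_cong_left) auto
    have "\<bar>X - entry (ramp \<rho> \<delta>) n u v\<bar> \<le> (entry (tent \<rho> \<delta>) n u u + entry (tent \<rho> \<delta>) n v v) / 2"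
      unfolding X using elim(4) by (intro entry_diff_bound step_minus_ramp_le_tent \<delta>) simp
    moreover have "entry (tent \<rho> \<delta>) n u u < 2 * e'" "entry (tent \<rho> \<delta>) n v v < 2 * e'"
      using T elim(1,2) by linarith+
    ultimately have "\<bar>X - entry (ramp \<rho> \<delta>) n u v\<bar> < 2 * e'"
      by argo
    moreover have "\<bar>?S - ?R\<bar> < e'"
      using SR T by linarith
    ultimately show ?case
      using elim(3) unfolding X_def[symmetric] dist_real_def e'_def by linarith
  qed
qed

end

section \<open>Completeness of an orthonormal basis\<close>

text \<open>A square matrix with orthonormal rows has orthonormal columns.  Bessel's inequality for the
  unit vector at \<open>x\<close> says \<open>S x x \<le> 1\<close>.  Both sides have the same sum over \<open>x\<close>, namely the number of rows, so equality holds
  for each \<open>x\<close>; then each unit vector equals its expansion.\<close>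
lemma dual_orthogonality:
  fixes \<psi> :: "nat \<Rightarrow> nat \<Rightarrow> real"
  assumes orth: "\<And>i j. i \<le> N \<Longrightarrow> j \<le> N \<Longrightarrow> (\<Sum>x\<le>N. \<psi> i x * \<psi> j x) = of_bool (i = j)"
    and x: "x \<le> N" and y: "y \<le> N"
  shows "(\<Sum>j\<le>N. \<psi> j x * \<psi> j y) = of_bool (x = y)"
proof -
  define S where "S x y = (\<Sum>j\<le>N. \<psi> j x * \<psi> j y)" for x y
  have SS: "(\<Sum>y\<le>N. S x y * S x y) = S x x" for x
  proof -
    have "(\<Sum>y\<le>N. S x y * S x y)
        = (\<Sum>y\<le>N. \<Sum>i\<le>N. \<Sum>j\<le>N. (\<psi> i x * \<psi> j x) * (\<psi> i y * \<psi> j y))"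
      by (simp add: S_def sum_product mult_ac)
    also have "\<dots> = (\<Sum>i\<le>N. \<Sum>j\<le>N. \<Sum>y\<le>N. (\<psi> i x * \<psi> j x) * (\<psi> i y * \<psi> j y))"
      by (subst sum.swap, rule sum.cong[OF refl], subst sum.swap) simp
    also have "\<dots> = (\<Sum>i\<le>N. \<Sum>j\<le>N. (\<psi> i x * \<psi> j x) * of_bool (i = j))"
      by (intro sum.cong refl) (simp add: sum_distrib_left[symmetric] orth)
    also have "\<dots> = (\<Sum>i\<le>N. \<psi> i x * \<psi> i x)"
      by (intro sum.cong refl) (simp add: of_bool_def if_distrib[of "(*) _"] cong: if_cong)
    finally show ?thesis by (simp add: S_def)
  qed
  have gap: "(\<Sum>y\<le>N. (of_bool (x = y) - S x y)\<^sup>2) = 1 - S x x" if "x \<le> N" for x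
  proof -
    have "(\<Sum>y\<le>N. (of_bool (x = y) - S x y)\<^sup>2)
        = (\<Sum>y\<le>N. of_bool (x = y) - 2 * (of_bool (x = y) * S x y) + S x y * S x y)"
      by (intro sum.cong refl) (simp add: power2_eq_square algebra_simps)
    also have "\<dots> = 1 - 2 * S x x + S x x"
      using that
      by (simp add: sum.distrib sum_subtractf SS sum_distrib_left[symmetric] of_bool_def
          if_distrib[of "\<lambda>z. z * _"] cong: if_cong)
    finally show ?thesis by simp
  qed
  have le: "0 \<le> 1 - S x x" if "x \<le> N" for x
    unfolding gap[OF that, symmetric] by (intro sum_nonneg) simp
  have "(\<Sum>x\<le>N. S x x) = (\<Sum>j\<le>N. \<Sum>x\<le>N. \<psi> j x * \<psi> j x)"
    unfolding S_def by (rule sum.swap)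
  also have "\<dots> = (\<Sum>j\<le>N. 1)"
    by (intro sum.cong refl) (simp add: orth)
  finally have "(\<Sum>x\<le>N. 1 - S x x) = 0"
    by (simp add: sum_subtractf)
  then have "1 - S x x = 0"
    using le x by (subst (asm) sum_nonneg_eq_0_iff) auto
  then have "(\<Sum>y\<le>N. (of_bool (x = y) - S x y)\<^sup>2) = 0"
    using gap[OF x] by simp
  then have "(of_bool (x = y) - S x y)\<^sup>2 = 0"
    using y by (subst (asm) sum_nonneg_eq_0_iff) auto
  then show ?thesis by (simp add: S_def)
qed

section \<open>The birth-death chain of the q-Krawtchouk weight\<close>

definition Krawtchouk_weight :: "real \<Rightarrow> real \<Rightarrow> nat \<Rightarrow> nat \<Rightarrow> real" where
  "Krawtchouk_weight q p N x =
     q_binomial q N x * p powi (- int x) * q powi (int (x choose 2) - int x * int N)"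

definition birth_rate :: "real \<Rightarrow> nat \<Rightarrow> nat \<Rightarrow> real" where
  "birth_rate q N x = sgn (q - 1) * (1 - q powi (int x - int N))"

definition death_rate :: "real \<Rightarrow> real \<Rightarrow> nat \<Rightarrow> real" where
  "death_rate q p x = sgn (q - 1) * p * (q ^ x - 1)"

text \<open>At the end points, \<open>f (x - 1)\<close> for \<open>x = 0\<close> and \<open>f (x + 1)\<close> for \<open>x = N\<close> carry the factors
  \<open>death_rate q p 0 = 0\<close> and \<open>birth_rate q N N = 0\<close>.\<close>
definition generator :: "real \<Rightarrow> real \<Rightarrow> nat \<Rightarrow> (nat \<Rightarrow> real) \<Rightarrow> nat \<Rightarrow> real" where
  "generator q p N f x =
     birth_rate q N x * (f (x + 1) - f x) + death_rate q p x * (f (x - 1) - f x)"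

definition Krawtchouk_eigenvalue :: "real \<Rightarrow> real \<Rightarrow> nat \<Rightarrow> real" where
  "Krawtchouk_eigenvalue q p j = sgn (q - 1) * (inverse q ^ j - 1 - p * (q ^ j - 1))"

lemma Krawtchouk_weight_pos:
  assumes "0 < q" "q \<noteq> 1" "0 < p"
  shows "0 < Krawtchouk_weight q p N x"
  unfolding Krawtchouk_weight_def using assms q_binomial_pos by simp

lemma birth_rate_nonneg:
  assumes "0 < q" "x \<le> N"
  shows "0 \<le> birth_rate q N x"
proof -
  have *: "q powi (int x - int N) = inverse (q ^ (N - x))"
    using assms by (simp add: power_int_def nat_diff_distrib' power_inverse)
  show ?thesis
  proof (cases "q \<le> 1")
    case True
    then have "1 \<le> inverse (q ^ (N - x))"
      using assms by (simp add: one_le_inverse power_le_one)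
    then show ?thesis using True by (auto simp: birth_rate_def * sgn_if)
  next
    case False
    then have "inverse (q ^ (N - x)) \<le> 1"
      by (simp add: inverse_le_1_iff)
    then show ?thesis using False by (auto simp: birth_rate_def * sgn_if)
  qed
qed

lemma death_rate_nonneg:
  assumes "0 < q" "0 < p"
  shows "0 \<le> death_rate q p x"
  using assms by (auto simp: death_rate_def sgn_if mult_le_0_iff power_le_one)

lemma detailed_balance:
  assumes q: "0 < q" "q \<noteq> 1" and p: "0 < p" and x: "x < N"
  shows "Krawtchouk_weight q p N x * birth_rate q N x
       = Krawtchouk_weight q p N (x + 1) * death_rate q p (x + 1)"
proof -
  have fact_Suc: "q_fact q (Suc m) = q_fact q m * q_number q (Suc m)" for m
    by (simp add: q_fact_def)
  have fact_pos: "q_fact q m > 0" for m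
    unfolding q_fact_def by (intro prod_pos) (auto intro!: q_number_pos q)
  have Nx: "N - x = Suc (N - Suc x)" using x by simp
  have num_pos: "q_number q (Suc m) > 0" for m
    using q_number_pos[OF q] by simp
  have binom: "q_binomial q N (Suc x) * q_number q (Suc x) = q_binomial q N x * q_number q (N - x)"
    unfolding q_binomial_def Nx fact_Suc
    using fact_pos[of x] fact_pos[of "N - Suc x"] num_pos[of x] num_pos[of "N - Suc x"]
    by (simp add: field_simps)
  have ne: "1 - q ^ Suc x \<noteq> 0" "1 - q \<noteq> 0"
    using num_pos[of x] q by (auto simp: q_number_def)
  then have binom': "q_binomial q N (Suc x) * (q ^ Suc x - 1) = q_binomial q N x * (q ^ (N - x) - 1)"
    using binom unfolding q_number_def by (simp add: field_simps)
  have qpow: "q powi (int (Suc x choose 2) - int (Suc x) * int N)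
      = q powi (int (x choose 2) - int x * int N) * q powi (int x - int N)"
    using q by (subst power_int_add[symmetric]) (auto simp: numeral_2_eq_2 algebra_simps)
  have ppow: "p powi (- int x) = p powi (- int (Suc x)) * p"
    using p power_int_add[of p "- int (Suc x)" 1] by simp
  have cancel: "q powi (int x - int N) * q ^ (N - x) = 1"
    using q x by (simp add: power_int_diff power_diff)
  have "Krawtchouk_weight q p N (x + 1) * death_rate q p (x + 1)
      = sgn (q - 1) * (p powi (- int (Suc x)) * p) * q powi (int (x choose 2) - int x * int N)
        * q powi (int x - int N) * (q_binomial q N (Suc x) * (q ^ Suc x - 1))"
    unfolding Krawtchouk_weight_def death_rate_def Suc_eq_plus1[symmetric] qpow by simp
  also have "\<dots> = sgn (q - 1) * p powi (- int x) * q powi (int (x choose 2) - int x * int N)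
        * q_binomial q N x * (q powi (int x - int N) * q ^ (N - x) - q powi (int x - int N))"
    unfolding binom' ppow[symmetric] by (simp add: algebra_simps)
  finally show ?thesis
    unfolding cancel by (simp add: Krawtchouk_weight_def birth_rate_def)
qed

text \<open>By detailed balance and summation by parts, both sides are the Dirichlet form of the chain.\<close>
lemma generator_symmetric:
  assumes q: "0 < q" "q \<noteq> 1" and p: "0 < p"
  shows "(\<Sum>x\<le>N. Krawtchouk_weight q p N x * generator q p N f x * g x)
       = (\<Sum>x\<le>N. Krawtchouk_weight q p N x * f x * generator q p N g x)"
proof -
  define w where "w = Krawtchouk_weight q p N"
  define b where "b x = w x * birth_rate q N x" for x
  define d where "d x = w x * death_rate q p x" for x
  have bd: "d (Suc x) = b x" if "x < N" for x
    using detailed_balance[OF q p that] by (simp add: b_def d_def w_def)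
  have bN: "b N = 0" and d0: "d 0 = 0"
    by (simp_all add: b_def d_def birth_rate_def death_rate_def)
  have Dirichlet: "(\<Sum>x\<le>N. w x * generator q p N f x * g x)
      = - (\<Sum>x<N. b x * (f (Suc x) - f x) * (g (Suc x) - g x))" for f g
  proof -
    have "(\<Sum>x\<le>N. w x * generator q p N f x * g x)
        = (\<Sum>x\<le>N. b x * (f (Suc x) - f x) * g x) + (\<Sum>x\<le>N. d x * (f (x - 1) - f x) * g x)"
      unfolding sum.distrib[symmetric]
      by (intro sum.cong refl) (simp add: generator_def b_def d_def algebra_simps)
    also have "(\<Sum>x\<le>N. b x * (f (Suc x) - f x) * g x) = (\<Sum>x<N. b x * (f (Suc x) - f x) * g x)"
      by (simp add: lessThan_Suc_atMost[symmetric] bN)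
    also have "(\<Sum>x\<le>N. d x * (f (x - 1) - f x) * g x)
        = (\<Sum>x<N. d (Suc x) * (f x - f (Suc x)) * g (Suc x))"
      by (simp add: lessThan_Suc_atMost[symmetric] sum.lessThan_Suc_shift d0 del: sum.lessThan_Suc)
    also have "\<dots> = (\<Sum>x<N. b x * (f x - f (Suc x)) * g (Suc x))"
      by (intro sum.cong refl) (simp add: bd)
    finally show ?thesis
      by (simp add: sum.distrib[symmetric] sum_negf[symmetric] algebra_simps)
  qed
  have "(\<Sum>x\<le>N. w x * generator q p N f x * g x) = (\<Sum>x\<le>N. w x * generator q p N g x * f x)"
    unfolding Dirichlet by (simp add: mult_ac)
  then show ?thesis by (simp add: w_def mult_ac)
qed

text \<open>In the variable \<open>z = q\<^sup>-\<^sup>x\<close> the steps \<open>x \<plusminus> 1\<close> are dilations by \<open>q\<^sup>\<mp>\<^sup>1\<close> and the rates are affine in \<open>1/z\<close>, so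
  \<open>z\<^sup>i\<close> is mapped to a combination of \<open>z\<^sup>i\<close> and \<open>z\<^sup>i\<^sup>-\<^sup>1\<close>.  The coefficient \<open>\<kappa> i\<close> of the latter vanishes for
  \<open>i = 0\<close>, so no negative power appears.\<close>
lemma generator_poly:
  fixes P :: "real poly"
  assumes q: "0 < q" and deg: "degree P \<le> m"
  obtains R where "degree R \<le> m"
    and "coeff R m = Krawtchouk_eigenvalue q p m * coeff P m"
    and "\<And>x. poly R (q powi (- int x)) = generator q p N (\<lambda>x. poly P (q powi (- int x))) x"
proof -
  define \<kappa> where "\<kappa> i = sgn (q - 1) * (p * (q ^ i - 1) - q powi (- int N) * (inverse q ^ i - 1))" for i
  define T where "T i = monom (Krawtchouk_eigenvalue q p i) i + monom (\<kappa> i) (i - 1)" for i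
  define R where "R = (\<Sum>i\<le>m. smult (coeff P i) (T i))"
  have \<kappa>0: "\<kappa> 0 = 0" by (simp add: \<kappa>_def)
  have T_high: "coeff (T i) r = 0" if "i < r" for i r
    using that by (simp add: T_def)
  have T_top: "coeff (T i) i = Krawtchouk_eigenvalue q p i" for i
    using \<kappa>0 by (cases i) (auto simp: T_def)
  have polyP: "poly P y = (\<Sum>i\<le>m. coeff P i * y ^ i)" for y
    by (metis (no_types, lifting) deg poly_as_sum_of_monoms' poly_monom poly_sum sum.cong)
  show ?thesis
  proof
    show "degree R \<le> m"
      by (rule degree_le) (auto simp: R_def coeff_sum T_high)
    have "coeff R m = (\<Sum>i\<le>m. if i = m then coeff P m * Krawtchouk_eigenvalue q p m else 0)"
      unfolding R_def coeff_sum by (intro sum.cong refl) (auto simp: T_high T_top)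
    then show "coeff R m = Krawtchouk_eigenvalue q p m * coeff P m"
      by (simp add: mult.commute)
    fix x
    define z where "z = q powi (- int x)"
    define Q where "Q = q powi (- int N)"
    have z: "z > 0" using q by (simp add: z_def)
    have up: "q powi (- int (x + 1)) = z * inverse q"
      using q power_int_add[of q "- int (x + 1)" 1] by (simp add: z_def field_simps)
    have birth: "birth_rate q N x = sgn (q - 1) * (1 - Q / z)"
      using q by (simp add: birth_rate_def Q_def z_def power_int_diff power_int_minus field_simps)
    have death: "death_rate q p x = sgn (q - 1) * p * (1 / z - 1)"
      using q by (simp add: death_rate_def z_def power_int_minus field_simps)
    have down: "death_rate q p x * h (q powi (- int (x - 1))) = death_rate q p x * h (z * q)"
      for h :: "real \<Rightarrow> real"
    proof (cases x)
      case 0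
      then show ?thesis by (simp add: death_rate_def)
    next
      case (Suc k)
      then have "q powi (- int (x - 1)) = z * q"
        using q power_int_add[of q "- int (Suc k)" 1] by (simp add: z_def)
      then show ?thesis by simp
    qed
    have "generator q p N (\<lambda>x. poly P (q powi (- int x))) x
        = birth_rate q N x * (poly P (z * inverse q) - poly P z)
          + death_rate q p x * (poly P (z * q) - poly P z)"
      using down[of "\<lambda>y. poly P y - poly P z"] unfolding generator_def up by (simp add: z_def)
    also have "\<dots> = (\<Sum>i\<le>m. coeff P i * (birth_rate q N x * ((z * inverse q) ^ i - z ^ i)
          + death_rate q p x * ((z * q) ^ i - z ^ i)))"
      unfolding polyP
      by (simp add: sum_distrib_left sum_subtractf[symmetric] sum.distrib[symmetric] algebra_simps)
    also have "\<dots> = (\<Sum>i\<le>m. coeff P i * poly (T i) z)"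
    proof (intro sum.cong refl arg_cong2[of _ _ _ _ "(*)"])
      fix i
      show "birth_rate q N x * ((z * inverse q) ^ i - z ^ i) + death_rate q p x * ((z * q) ^ i - z ^ i)
          = poly (T i) z"
      proof (cases i)
        case 0
        then show ?thesis by (simp add: T_def \<kappa>0 poly_monom Krawtchouk_eigenvalue_def)
      next
        case (Suc k)
        have zi: "z ^ i = z ^ k * z" "i - 1 = k" by (simp_all add: Suc)
        have "s * (1 - Q / z) * (z ^ k * z * A - z ^ k * z) + s * p * (1 / z - 1) * (z ^ k * z * B - z ^ k * z)
            = s * (A - 1 - p * (B - 1)) * (z ^ k * z) + s * (p * (B - 1) - Q * (A - 1)) * z ^ k" for s A B
          using z by (simp add: field_simps)
        then show ?thesis
          unfolding T_def poly_add poly_monom Krawtchouk_eigenvalue_def \<kappa>_def birth death Q_def[symmetric]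
            power_mult_distrib zi .
      qed
    qed
    also have "\<dots> = poly R z"
      by (simp add: R_def poly_sum)
    finally show "poly R (q powi (- int x)) = generator q p N (\<lambda>x. poly P (q powi (- int x))) x"
      by (simp add: z_def)
  qed
qed

lemma normalized_q_Krawtchouk_orthonormal:
  assumes "normalized_q_Krawtchouk q p N P" "i \<le> N" "j \<le> N"
  shows "(\<Sum>x\<le>N. Krawtchouk_weight q p N x * poly (P i) (q powi (- int x)) * poly (P j) (q powi (- int x)))
       = of_bool (i = j)"
  using assms unfolding normalized_q_Krawtchouk_def Krawtchouk_weight_def
  by (simp add: atLeast0AtMost)

text \<open>Polynomials of degree below \<open>j\<close> are combinations of \<open>P 0, ..., P (j - 1)\<close>: the leading term is
  removed by a multiple of the orthonormal polynomial of that degree.\<close>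
lemma normalized_q_Krawtchouk_orthogonal_lower_degree:
  assumes P: "normalized_q_Krawtchouk q p N P" and j: "j \<le> N"
    and f: "\<And>i. j \<le> i \<Longrightarrow> coeff f i = 0"
  shows "(\<Sum>x\<le>N. Krawtchouk_weight q p N x * poly f (q powi (- int x)) * poly (P j) (q powi (- int x))) = 0"
proof -
  have deg: "degree (P i) = i" if "i \<le> N" for i
    using P that by (simp add: normalized_q_Krawtchouk_def)
  define ip where "ip f g = (\<Sum>x\<le>N. Krawtchouk_weight q p N x
      * poly f (q powi (- int x)) * poly g (q powi (- int x)))" for f g
  have "ip f (P j) = 0" if "m \<le> j" "\<And>i. m \<le> i \<Longrightarrow> coeff f i = 0" for m f
    using that
  proof (induction m arbitrary: f)
    case 0
    then have "f = 0" by (intro poly_eqI) simp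
    then show ?case by (simp add: ip_def)
  next
    case (Suc m)
    then have m: "m < j" "m \<le> N" using j by simp_all
    have "P m \<noteq> 0"
      using normalized_q_Krawtchouk_orthonormal[OF P m(2) m(2)] by auto
    then have lead: "coeff (P m) m \<noteq> 0"
      using deg[OF m(2)] by (metis leading_coeff_0_iff)
    define a where "a = coeff f m / coeff (P m) m"
    define g where "g = f - smult a (P m)"
    have "coeff g i = 0" if "m \<le> i" for i
    proof (cases "i = m")
      case True
      then show ?thesis using lead by (simp add: g_def a_def)
    next
      case False
      then have "coeff (P m) i = 0" using that deg[OF m(2)] by (intro coeff_eq_0) simp
      then show ?thesis using that False Suc.prems(2)[of i] by (simp add: g_def)
    qed
    then have "ip g (P j) = 0" using Suc.IH m by simp
    moreover have "ip f (P j) = ip g (P j) + a * ip (P m) (P j)"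
      by (simp add: ip_def g_def sum_distrib_left sum.distrib[symmetric] algebra_simps)
    moreover have "ip (P m) (P j) = 0"
      using normalized_q_Krawtchouk_orthonormal[OF P m(2) j] m by (simp add: ip_def)
    ultimately show ?case by simp
  qed
  from this[OF order_refl] f show ?thesis by (simp add: ip_def)
qed

text \<open>Let \<open>f\<close> be the image of \<open>P j\<close> minus the eigenvalue times \<open>P j\<close>.  It has degree below \<open>j\<close>, and by
  symmetry of the generator, which preserves such polynomials, it is orthogonal to itself.\<close>
lemma generator_eigenfunction:
  assumes q: "0 < q" "q \<noteq> 1" and p: "0 < p"
    and P: "normalized_q_Krawtchouk q p N P" and j: "j \<le> N" and x: "x \<le> N"
  shows "generator q p N (\<lambda>x. poly (P j) (q powi (- int x))) x
       = Krawtchouk_eigenvalue q p j * poly (P j) (q powi (- int x))"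
proof -
  define w where "w = Krawtchouk_weight q p N"
  define ev where "ev f x = poly f (q powi (- int x))" for f x
  have deg: "degree (P i) = i" if "i \<le> N" for i
    using P that by (simp add: normalized_q_Krawtchouk_def)
  have lower: "(\<Sum>x\<le>N. w x * ev f x * ev (P j) x) = 0"
    if "\<And>i. j \<le> i \<Longrightarrow> coeff f i = 0" for f
    using normalized_q_Krawtchouk_orthogonal_lower_degree[OF P j that] by (simp add: w_def ev_def)
  obtain R where R: "degree R \<le> j" "coeff R j = Krawtchouk_eigenvalue q p j * coeff (P j) j"
      "\<And>x. ev R x = generator q p N (ev (P j)) x"
    using generator_poly[OF q(1), of "P j" j p N] deg[OF j] unfolding ev_def by (metis order_refl)
  define f where "f = R - smult (Krawtchouk_eigenvalue q p j) (P j)"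
  have f_low: "coeff f i = 0" if "j \<le> i" for i
    using that R(1,2) deg[OF j] coeff_eq_0[of R i] coeff_eq_0[of "P j" i]
    by (cases "i = j") (simp_all add: f_def)
  have "f = 0 \<or> degree f < j"
    by (metis f_low leading_coeff_0_iff not_le)
  \<comment> \<open>the zero polynomial has degree 0, which is not below j if j = 0\<close>
  then obtain m where m: "m \<le> j" "degree f \<le> m" "f = 0 \<or> m < j"
    by (metis degree_0 le0 less_imp_le order_refl)
  obtain g where g: "degree g \<le> m" "\<And>x. ev g x = generator q p N (ev f) x"
    using generator_poly[OF q(1) m(2), of p N] unfolding ev_def by metis
  have g_low: "(\<Sum>x\<le>N. w x * ev g x * ev (P j) x) = 0"
  proof (cases "f = 0")
    case True
    then have "ev g x = 0" for x unfolding g(2) by (simp add: generator_def ev_def)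
    then show ?thesis by simp
  next
    case False
    then show ?thesis using m(3) g(1) by (intro lower coeff_eq_0) simp
  qed
  have "(\<Sum>x\<le>N. w x * ev f x * ev f x)
      = (\<Sum>x\<le>N. w x * ev f x * generator q p N (ev (P j)) x)
        - Krawtchouk_eigenvalue q p j * (\<Sum>x\<le>N. w x * ev f x * ev (P j) x)"
    unfolding R(3)[symmetric]
    by (simp add: f_def ev_def sum_distrib_left sum_subtractf[symmetric] algebra_simps)
  also have "(\<Sum>x\<le>N. w x * ev f x * generator q p N (ev (P j)) x)
      = (\<Sum>x\<le>N. w x * ev g x * ev (P j) x)"
    unfolding g(2) w_def by (rule generator_symmetric[OF q p, symmetric])
  finally have "(\<Sum>x\<le>N. w x * ev f x * ev f x) = 0"
    using g_low lower[OF f_low] by simp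
  then have "w x * ev f x * ev f x = 0"
    using x Krawtchouk_weight_pos[OF q p]
    by (subst (asm) sum_nonneg_eq_0_iff) (auto simp: w_def mult.assoc less_imp_le)
  then have "ev f x = 0"
    using Krawtchouk_weight_pos[OF q p, of N x] by (auto simp: w_def)
  moreover have "(\<lambda>x. poly (P j) (q powi (- int x))) = ev (P j)"
    by (simp add: ev_def fun_eq_iff)
  ultimately show ?thesis
    using R(3)[of x] by (simp add: f_def ev_def)
qed

definition Krawtchouk_function :: "real \<Rightarrow> real \<Rightarrow> nat \<Rightarrow> (nat \<Rightarrow> real poly) \<Rightarrow> nat \<Rightarrow> nat \<Rightarrow> real" where
  "Krawtchouk_function q p N P j x = sqrt (Krawtchouk_weight q p N x) * poly (P j) (q powi (- int x))"

lemma Krawtchouk_function_complete: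
  assumes q: "0 < q" "q \<noteq> 1" and p: "0 < p"
    and P: "normalized_q_Krawtchouk q p N P" and x: "x \<le> N" and y: "y \<le> N"
  shows "(\<Sum>j\<le>N. Krawtchouk_function q p N P j x * Krawtchouk_function q p N P j y) = of_bool (x = y)"
proof (rule dual_orthogonality[OF _ x y])
  fix i j assume ij: "i \<le> N" "j \<le> N"
  have "Krawtchouk_function q p N P i x * Krawtchouk_function q p N P j x
      = Krawtchouk_weight q p N x * poly (P i) (q powi (- int x)) * poly (P j) (q powi (- int x))" for x
  proof -
    have "sqrt (Krawtchouk_weight q p N x) * sqrt (Krawtchouk_weight q p N x) = Krawtchouk_weight q p N x"
      using Krawtchouk_weight_pos[OF q p, of N x] by simp
    then show ?thesis unfolding Krawtchouk_function_def by (simp add: algebra_simps)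
  qed
  then show "(\<Sum>x\<le>N. Krawtchouk_function q p N P i x * Krawtchouk_function q p N P j x) = of_bool (i = j)"
    using normalized_q_Krawtchouk_orthonormal[OF P ij] by simp
qed

text \<open>The off-diagonal entry between the sites \<open>x\<close> and \<open>x + 1\<close> of the generator after conjugation by
  the square root of the weight.\<close>
definition Jacobi_entry :: "real \<Rightarrow> real \<Rightarrow> nat \<Rightarrow> nat \<Rightarrow> real" where
  "Jacobi_entry q p N x = sqrt (birth_rate q N x * death_rate q p (x + 1))"

text \<open>The eigenvalue equation in symmetric form: detailed balance splits each weighted rate into a
  square root of the neighbouring weight and the geometric mean of two rates.\<close>
lemma Krawtchouk_function_three_term:
  assumes q: "0 < q" "q \<noteq> 1" and p: "0 < p"
    and P: "normalized_q_Krawtchouk q p N P" and j: "j \<le> N" and x: "Suc x < N"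
  shows "Krawtchouk_eigenvalue q p j * Krawtchouk_function q p N P j (Suc x)
       = Jacobi_entry q p N (Suc x) * Krawtchouk_function q p N P j (Suc (Suc x))
         - (birth_rate q N (Suc x) + death_rate q p (Suc x)) * Krawtchouk_function q p N P j (Suc x)
         + Jacobi_entry q p N x * Krawtchouk_function q p N P j x"
proof -
  define w where "w = Krawtchouk_weight q p N"
  have w: "w y > 0" for y using Krawtchouk_weight_pos[OF q p] by (simp add: w_def)
  have b: "birth_rate q N y \<ge> 0" if "y \<le> N" for y using birth_rate_nonneg[OF q(1) that] .
  have d: "death_rate q p y \<ge> 0" for y using death_rate_nonneg[OF q(1) p] .
  have bal: "w y * birth_rate q N y = w (Suc y) * death_rate q p (Suc y)" if "y < N" for y
    using detailed_balance[OF q p that] by (simp add: w_def)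
  have up: "sqrt (w y) * birth_rate q N y = Jacobi_entry q p N y * sqrt (w (Suc y))" if "y < N" for y
  proof -
    have "sqrt (w y) * birth_rate q N y = sqrt (w y) * sqrt (birth_rate q N y) * sqrt (birth_rate q N y)"
      using b[of y] that by simp
    also have "\<dots> = sqrt (w y * birth_rate q N y * birth_rate q N y)"
      by (simp add: real_sqrt_mult)
    also have "\<dots> = Jacobi_entry q p N y * sqrt (w (Suc y))"
      unfolding bal[OF that] by (simp add: real_sqrt_mult Jacobi_entry_def)
    finally show ?thesis .
  qed
  have down: "sqrt (w (Suc y)) * death_rate q p (Suc y) = Jacobi_entry q p N y * sqrt (w y)" if "y < N" for y
  proof -
    have "sqrt (w (Suc y)) * death_rate q p (Suc y)
        = sqrt (w (Suc y)) * sqrt (death_rate q p (Suc y)) * sqrt (death_rate q p (Suc y))"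
      using d[of "Suc y"] by simp
    also have "\<dots> = sqrt (w (Suc y) * death_rate q p (Suc y) * death_rate q p (Suc y))"
      by (simp add: real_sqrt_mult)
    also have "\<dots> = Jacobi_entry q p N y * sqrt (w y)"
      unfolding bal[OF that, symmetric] by (simp add: real_sqrt_mult Jacobi_entry_def)
    finally show ?thesis .
  qed
  define e where "e y = poly (P j) (q powi (- int y))" for y
  have psi: "Krawtchouk_function q p N P j y = sqrt (w y) * e y" for y
    by (simp add: Krawtchouk_function_def w_def e_def)
  have "Krawtchouk_eigenvalue q p j * e (Suc x) = generator q p N e (Suc x)"
    using generator_eigenfunction[OF q p P j, of "Suc x"] x unfolding e_def by simp
  then have "Krawtchouk_eigenvalue q p j * (sqrt (w (Suc x)) * e (Suc x))
      = sqrt (w (Suc x)) * generator q p N e (Suc x)"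
    by (metis mult.left_commute)
  also have "\<dots> = (sqrt (w (Suc x)) * birth_rate q N (Suc x)) * e (Suc (Suc x))
      - (birth_rate q N (Suc x) + death_rate q p (Suc x)) * (sqrt (w (Suc x)) * e (Suc x))
      + (sqrt (w (Suc x)) * death_rate q p (Suc x)) * e x"
    by (simp add: generator_def algebra_simps)
  also have "\<dots> = Jacobi_entry q p N (Suc x) * (sqrt (w (Suc (Suc x))) * e (Suc (Suc x)))
      - (birth_rate q N (Suc x) + death_rate q p (Suc x)) * (sqrt (w (Suc x)) * e (Suc x))
      + Jacobi_entry q p N x * (sqrt (w x) * e x)"
    using x by (simp only: up down Suc_lessD mult.assoc)
  finally show ?thesis by (simp only: psi)
qed

text \<open>Both \<open>\<sigma> q\<^sup>-\<^sup>j\<close> and \<open>- \<sigma> p q\<^sup>j\<close> decrease in \<open>j\<close>, since \<open>\<sigma>\<close> is the sign of \<open>q - 1\<close>.\<close>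
lemma Krawtchouk_eigenvalue_less_iff:
  assumes q: "0 < q" "q \<noteq> 1" and p: "0 < p"
  shows "Krawtchouk_eigenvalue q p i < Krawtchouk_eigenvalue q p j \<longleftrightarrow> j < i"
proof -
  have "Krawtchouk_eigenvalue q p i < Krawtchouk_eigenvalue q p j" if "j < i" for i j
  proof (cases "q < 1")
    case True
    have 1: "q ^ i < q ^ j" using True q that by (simp add: power_strict_decreasing)
    have 2: "inverse q ^ j < inverse q ^ i"
      using True q that by (intro power_strict_increasing) (auto simp: one_less_inverse)
    have "p * q ^ i < p * q ^ j" using 1 p by simp
    then show ?thesis using True 2 by (simp add: Krawtchouk_eigenvalue_def algebra_simps)
  next
    case False
    have 1: "q ^ j < q ^ i" using False q that by (simp add: power_strict_increasing)
    have 2: "inverse q ^ i < inverse q ^ j"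
      using False q that by (intro power_strict_decreasing) (auto simp: inverse_less_1_iff)
    have "p * q ^ j < p * q ^ i" using 1 p by simp
    then show ?thesis using False q 2 by (simp add: Krawtchouk_eigenvalue_def algebra_simps)
  qed
  from this[of i j] this[of j i] show ?thesis
    by (metis less_asym linorder_less_linear less_irrefl)
qed

section \<open>The scaling limit\<close>

lemma power_int_exp_limit:
  fixes q :: "nat \<Rightarrow> real" and m :: "nat \<Rightarrow> int"
  assumes q: "\<forall>n\<ge>1. q n = 1 - \<gamma> / real n"
    and m: "(\<lambda>n. of_int (m n) / real n) \<longlonglongrightarrow> s"
  shows "(\<lambda>n. q n powi m n) \<longlonglongrightarrow> exp (- \<gamma> * s)"
proof -
  have "(\<lambda>n. 1 - \<gamma> / real n) \<longlonglongrightarrow> 1 - 0"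
    by (intro tendsto_intros lim_const_over_n)
  then have pos: "\<forall>\<^sub>F n in sequentially. 0 < 1 - \<gamma> / real n"
    by (rule order_tendstoD) simp
  have "(\<lambda>n. ln ((1 + (- \<gamma>) / real n) ^ n)) \<longlonglongrightarrow> ln (exp (- \<gamma>))"
    by (rule tendsto_ln[OF tendsto_exp_limit_sequentially]) simp
  from tendsto_exp[OF tendsto_mult[OF m this]]
  have "(\<lambda>n. exp (of_int (m n) / real n * ln ((1 + (- \<gamma>) / real n) ^ n))) \<longlonglongrightarrow> exp (s * ln (exp (- \<gamma>)))" .
  moreover have "\<forall>\<^sub>F n in sequentially.
      exp (of_int (m n) / real n * ln ((1 + (- \<gamma>) / real n) ^ n)) = q n powi m n"
    using pos eventually_ge_at_top[of 1]
  proof eventually_elim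
    case (elim n)
    then have "exp (of_int (m n) / real n * ln ((1 + (- \<gamma>) / real n) ^ n)) = exp (of_int (m n) * ln (q n))"
      by (simp add: ln_realpow q)
    also have "\<dots> = q n powr of_int (m n)"
      using elim by (simp add: powr_def q)
    also have "\<dots> = q n powi m n"
      using elim by (intro powr_real_of_int') (auto simp: q)
    finally show ?case .
  qed
  ultimately have "(\<lambda>n. q n powi m n) \<longlonglongrightarrow> exp (s * ln (exp (- \<gamma>)))"
    by (rule Lim_transform_eventually)
  then show ?thesis by (simp add: mult.commute)
qed

lemma floor_shift_ratio_limit:
  "(\<lambda>n. of_int (\<lfloor>real n * t\<rfloor> + u) / real n) \<longlonglongrightarrow> t"
proof (rule Lim_null[THEN iffD2], rule Lim_null_comparison)
  show "(\<lambda>n. (1 + \<bar>of_int u\<bar>) / real n) \<longlonglongrightarrow> 0"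
    by (rule lim_const_over_n)
  show "\<forall>\<^sub>F n in sequentially. norm (of_int (\<lfloor>real n * t\<rfloor> + u) / real n - t) \<le> (1 + \<bar>of_int u\<bar>) / real n"
    using eventually_gt_at_top[of 0]
  proof eventually_elim
    case (elim n)
    have "\<bar>of_int (\<lfloor>real n * t\<rfloor> + u) - real n * t\<bar> \<le> 1 + \<bar>real_of_int u\<bar>"
      using floor_correct[of "real n * t"] by simp linarith
    moreover have "of_int (\<lfloor>real n * t\<rfloor> + u) / real n - t = (of_int (\<lfloor>real n * t\<rfloor> + u) - real n * t) / real n"
      using elim by (simp add: field_simps)
    ultimately show ?case
      using elim by (simp add: abs_divide divide_right_mono)
  qed
qed

text \<open>The common form of both cases.  The quotient \<open>C\<close> is \<open>(\<rho> - \<beta>)/(2\<alpha>)\<close>, where \<open>\<rho>\<close> is the limit of the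
  eigenvalue with index \<open>n\<close>, \<open>\<beta>\<close> that of the diagonal entries and \<open>\<alpha>\<close> that of the off-diagonal entries of
  the Jacobi matrix at the site \<open>nt\<close>.\<close>
lemma q_Krawtchouk_sine_limit:
  fixes c \<gamma> t g :: real and k :: "nat \<Rightarrow> nat" and q p :: "nat \<Rightarrow> real" and u v :: int
  defines "C \<equiv> sgn (- \<gamma>) * (exp \<gamma> - exp (g - \<gamma>) - exp (\<gamma> * (c + 1 - t)) + exp (g - \<gamma> * t))
      / (2 * (exp ((g - \<gamma> * t) / 2) * sqrt ((1 - exp (\<gamma> * t)) * (1 - exp (\<gamma> * (c + 1 - t))))))"
  assumes \<gamma>: "\<gamma> \<noteq> 0" and k: "filterlim k at_top sequentially"
    and kn: "(\<lambda>n. real (k n) / real n) \<longlonglongrightarrow> c"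
    and q: "\<forall>n\<ge>1. q n = 1 - \<gamma> / real n"
    and t: "0 < t" "t < c + 1"
    and p_pos: "\<forall>\<^sub>F n in sequentially. 0 < p n" and p_lim: "p \<longlonglongrightarrow> exp g"
    and W: "\<forall>\<^sub>F n in sequentially. W n = Krawtchouk_weight (q n) (p n) (n + k n - 1)"
    and P: "\<forall>\<^sub>F n in sequentially. normalized_q_Krawtchouk (q n) (p n) (n + k n - 1) (P n)"
    and C: "C \<in> {-1..1}"
  shows "(\<lambda>n. q_Krawtchouk_kernel (q n) (P n) (W n) n (nat (\<lfloor>real n * t\<rfloor> + u)) (nat (\<lfloor>real n * t\<rfloor> + v)))
      \<longlonglongrightarrow> discrete_sine_kernel (arccos C) u v"
proof -
  define N where "N n = n + k n - 1" for n
  define x where "x n u = nat (\<lfloor>real n * t\<rfloor> + u)" for n u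
  define \<sigma> where "\<sigma> = sgn (- \<gamma>)"
  define \<nu> where "\<nu> n j = Krawtchouk_eigenvalue (q n) (p n) j" for n j
  define \<psi> where "\<psi> n j u = Krawtchouk_function (q n) (p n) (N n) (P n) j (x n u)" for n j u
  define a where "a n u = Jacobi_entry (q n) (p n) (N n) (x n u)" for n u
  define b where "b n u = - (birth_rate (q n) (N n) (x n u) + death_rate (q n) (p n) (x n u))" for n u
  \<comment> \<open>the limits of the birth and death rates at nt, and of the eigenvalue with an index close to ns\<close>
  define B where "B = \<sigma> * (1 - exp (\<gamma> * (c + 1 - t)))"
  define D where "D = \<sigma> * exp g * (exp (- \<gamma> * t) - 1)"
  define ev where "ev s = \<sigma> * (exp (\<gamma> * s) - 1 - exp g * (exp (- \<gamma> * s) - 1))" for s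
  have k1: "\<forall>\<^sub>F n in sequentially. 1 \<le> k n"
    using k by (auto simp: filterlim_at_top)
  have "(\<lambda>n. 1 - \<gamma> / real n) \<longlonglongrightarrow> 1 - 0"
    by (intro tendsto_intros lim_const_over_n)
  then have pos: "\<forall>\<^sub>F n in sequentially. 0 < 1 - \<gamma> / real n"
    by (rule order_tendstoD) simp
  have q_ok: "\<forall>\<^sub>F n in sequentially. 0 < q n \<and> q n \<noteq> 1 \<and> sgn (q n - 1) = \<sigma>"
    using pos eventually_ge_at_top[of 1]
    by eventually_elim (use \<gamma> in \<open>auto simp: q \<sigma>_def sgn_if zero_less_divide_iff divide_less_0_iff\<close>)
  have ok: "\<forall>\<^sub>F n in sequentially. 0 < q n \<and> q n \<noteq> 1 \<and> sgn (q n - 1) = \<sigma> \<and> 0 < p n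
      \<and> normalized_q_Krawtchouk (q n) (p n) (N n) (P n)
      \<and> W n = Krawtchouk_weight (q n) (p n) (N n) \<and> n \<le> N n"
    using q_ok p_pos P W k1 by eventually_elim (auto simp: N_def)
  have N_ratio: "(\<lambda>n. real (N n) / real n) \<longlonglongrightarrow> c + 1"
  proof (rule Lim_transform_eventually)
    have "(\<lambda>n. real (k n) / real n + 1 - 1 / real n) \<longlonglongrightarrow> c + 1 - 0"
      by (intro tendsto_intros kn lim_const_over_n)
    then show "(\<lambda>n. real (k n) / real n + 1 - 1 / real n) \<longlonglongrightarrow> c + 1" by simp
    show "\<forall>\<^sub>F n in sequentially. real (k n) / real n + 1 - 1 / real n = real (N n) / real n"
      using eventually_ge_at_top[of 1]
      by eventually_elim (auto simp: N_def of_nat_diff field_simps)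
  qed
  have window: "\<forall>\<^sub>F n in sequentially. 0 < \<lfloor>real n * t\<rfloor> + u \<and> \<lfloor>real n * t\<rfloor> + u < int (N n)" for u
  proof -
    have "\<forall>\<^sub>F n in sequentially. 0 < of_int (\<lfloor>real n * t\<rfloor> + u) / real n"
      using order_tendstoD(1)[OF floor_shift_ratio_limit t(1)] .
    moreover have "(\<lambda>n. real (N n) / real n - of_int (\<lfloor>real n * t\<rfloor> + u) / real n) \<longlonglongrightarrow> (c + 1) - t"
      by (intro tendsto_intros N_ratio floor_shift_ratio_limit)
    then have "\<forall>\<^sub>F n in sequentially. 0 < real (N n) / real n - of_int (\<lfloor>real n * t\<rfloor> + u) / real n"
      by (rule order_tendstoD) (use t in simp)
    ultimately show ?thesis
      using eventually_gt_at_top[of 0]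
    proof eventually_elim
      case (elim n)
      have "0 < real_of_int (\<lfloor>real n * t\<rfloor> + u)"
        using elim(1,3) by (simp add: zero_less_divide_iff)
      moreover have "real_of_int (\<lfloor>real n * t\<rfloor> + u) < real_of_int (int (N n))"
        using elim(2,3) by (simp add: divide_strict_right_mono divide_less_cancel)
      ultimately show ?case by linarith
    qed
  qed
  have x_ratio: "(\<lambda>n. real (x n u) / real n) \<longlonglongrightarrow> t" for u
  proof (rule Lim_transform_eventually[OF floor_shift_ratio_limit])
    show "\<forall>\<^sub>F n in sequentially. of_int (\<lfloor>real n * t\<rfloor> + u) / real n = real (x n u) / real n"
      using window[of u] by eventually_elim (auto simp: x_def)
  qed
  have power_lim: "(\<lambda>n. q n ^ X n) \<longlonglongrightarrow> exp (- \<gamma> * s)" if "(\<lambda>n. real (X n) / real n) \<longlonglongrightarrow> s" for X s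
    using power_int_exp_limit[where q = q and \<gamma> = \<gamma> and m = "\<lambda>n. int (X n)" and s = s, OF q] that by simp
  have inverse_power_lim: "(\<lambda>n. inverse (q n) ^ X n) \<longlonglongrightarrow> exp (\<gamma> * s)"
    if "(\<lambda>n. real (X n) / real n) \<longlonglongrightarrow> s" for X s
    using tendsto_inverse[OF power_lim[OF that]] by (simp add: power_inverse exp_minus[symmetric])
  have birth_lim: "(\<lambda>n. birth_rate (q n) (N n) (X n)) \<longlonglongrightarrow> B"
    if X: "(\<lambda>n. real (X n) / real n) \<longlonglongrightarrow> t" for X
  proof (rule Lim_transform_eventually)
    have "(\<lambda>n. real_of_int (int (X n) - int (N n)) / real n) \<longlonglongrightarrow> t - (c + 1)"
      using tendsto_diff[OF X N_ratio] by (simp add: diff_divide_distrib)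
    then have "(\<lambda>n. \<sigma> * (1 - q n powi (int (X n) - int (N n)))) \<longlonglongrightarrow> \<sigma> * (1 - exp (- \<gamma> * (t - (c + 1))))"
      by (intro tendsto_intros power_int_exp_limit q)
    then show "(\<lambda>n. \<sigma> * (1 - q n powi (int (X n) - int (N n)))) \<longlonglongrightarrow> B"
      by (simp add: B_def algebra_simps)
    show "\<forall>\<^sub>F n in sequentially. \<sigma> * (1 - q n powi (int (X n) - int (N n))) = birth_rate (q n) (N n) (X n)"
      using q_ok by eventually_elim (simp add: birth_rate_def)
  qed
  have death_lim: "(\<lambda>n. death_rate (q n) (p n) (X n)) \<longlonglongrightarrow> D"
    if X: "(\<lambda>n. real (X n) / real n) \<longlonglongrightarrow> t" for X
  proof (rule Lim_transform_eventually)
    show "(\<lambda>n. \<sigma> * p n * (q n ^ X n - 1)) \<longlonglongrightarrow> D"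
      unfolding D_def by (intro tendsto_intros p_lim power_lim X)
    show "\<forall>\<^sub>F n in sequentially. \<sigma> * p n * (q n ^ X n - 1) = death_rate (q n) (p n) (X n)"
      using q_ok by eventually_elim (simp add: death_rate_def)
  qed
  have ev_lim: "(\<lambda>n. \<nu> n (X n)) \<longlonglongrightarrow> ev s" if X: "(\<lambda>n. real (X n) / real n) \<longlonglongrightarrow> s" for X s
  proof (rule Lim_transform_eventually)
    show "(\<lambda>n. \<sigma> * (inverse (q n) ^ X n - 1 - p n * (q n ^ X n - 1))) \<longlonglongrightarrow> ev s"
      unfolding ev_def by (intro tendsto_intros p_lim power_lim inverse_power_lim X)
    show "\<forall>\<^sub>F n in sequentially. \<sigma> * (inverse (q n) ^ X n - 1 - p n * (q n ^ X n - 1)) = \<nu> n (X n)"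
      using q_ok by eventually_elim (simp add: \<nu>_def Krawtchouk_eigenvalue_def)
  qed
  \<comment> \<open>both factors under the root have the sign opposite to \<gamma>, so the off-diagonal limit is positive\<close>
  define S where "S = sqrt ((1 - exp (\<gamma> * t)) * (1 - exp (\<gamma> * (c + 1 - t))))"
  define \<alpha> where "\<alpha> = exp ((g - \<gamma> * t) / 2) * S"
  have S: "0 < S"
  proof (cases "0 < \<gamma>")
    case True
    then show ?thesis using t by (auto simp: S_def intro!: mult_neg_neg)
  next
    case False
    then have "\<gamma> < 0" using \<gamma> by simp
    then show ?thesis using t by (auto simp: S_def mult_neg_pos intro!: mult_pos_pos)
  qed
  have \<sigma>2: "\<sigma> * \<sigma> = 1" using \<gamma> by (auto simp: \<sigma>_def sgn_if)
  have "exp g * (exp (- \<gamma> * t) - 1) = exp (g - \<gamma> * t) * (1 - exp (\<gamma> * t))"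
    by (simp add: right_diff_distrib exp_add[symmetric])
  then have "B * D = (\<sigma> * \<sigma>) * (exp (g - \<gamma> * t) * ((1 - exp (\<gamma> * t)) * (1 - exp (\<gamma> * (c + 1 - t)))))"
    unfolding B_def D_def by (metis mult.assoc mult.commute)
  also have "exp (g - \<gamma> * t) = (exp ((g - \<gamma> * t) / 2))\<^sup>2"
    by (simp add: power2_eq_square exp_add[symmetric])
  finally have BD: "sqrt (B * D) = \<alpha>"
    unfolding \<sigma>2 \<alpha>_def S_def by (simp add: real_sqrt_mult)
  have C_eq: "C = (ev 1 - (- (B + D))) / (2 * \<alpha>)"
  proof -
    have "ev 1 - (- (B + D))
        = \<sigma> * (exp \<gamma> - exp g * exp (- \<gamma>) - exp (\<gamma> * (c + 1 - t)) + exp g * exp (- \<gamma> * t))"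
      unfolding ev_def B_def D_def by (simp add: algebra_simps)
    also have "\<dots> = \<sigma> * (exp \<gamma> - exp (g - \<gamma>) - exp (\<gamma> * (c + 1 - t)) + exp (g - \<gamma> * t))"
      by (simp add: exp_add[symmetric])
    finally show ?thesis unfolding C_def \<alpha>_def S_def \<sigma>_def by simp
  qed
  interpret locally_Laurent_Jacobi N \<nu> \<psi> a b \<alpha> "- (B + D)" "\<bar>ev (c + 1)\<bar> + 1"
  proof
    show "\<forall>\<^sub>F n in sequentially. (\<Sum>j\<le>N n. \<psi> n j u * \<psi> n j v) = of_bool (u = v)" for u v
      using ok window[of u] window[of v]
    proof eventually_elim
      case (elim n)
      then have "x n u \<le> N n" "x n v \<le> N n" "x n u = x n v \<longleftrightarrow> u = v"
        by (auto simp: x_def)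
      then show ?case
        using elim Krawtchouk_function_complete[of "q n" "p n" "N n" "P n" "x n u" "x n v"]
        by (simp add: \<psi>_def)
    qed
    show "\<forall>\<^sub>F n in sequentially. \<forall>j\<le>N n.
        \<nu> n j * \<psi> n j u = a n u * \<psi> n j (u + 1) + b n u * \<psi> n j u + a n (u - 1) * \<psi> n j (u - 1)" for u
      using ok window[of u]
    proof eventually_elim
      case (elim n)
      define y where "y = x n (u - 1)"
      have y: "x n u = Suc y" "x n (u + 1) = Suc (Suc y)" "Suc y < N n"
        using elim by (auto simp: x_def y_def)
      have "\<nu> n j * \<psi> n j u = a n u * \<psi> n j (u + 1) + b n u * \<psi> n j u + a n (u - 1) * \<psi> n j (u - 1)"
        if "j \<le> N n" for j
        using elim Krawtchouk_function_three_term[OF _ _ _ _ that y(3), of "q n" "p n" "P n"]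
        unfolding \<nu>_def \<psi>_def a_def b_def y(1,2) y_def[symmetric]
        by (simp only: mult_minus_left add_uminus_conv_diff simp_thms)
      then show ?case by blast
    qed
    show "\<forall>\<^sub>F n in sequentially. \<forall>j\<le>N n. \<bar>\<nu> n j\<bar> \<le> \<bar>ev (c + 1)\<bar> + 1"
      using ok tendstoD[OF ev_lim[OF N_ratio] zero_less_one]
    proof eventually_elim
      case (elim n)
      \<comment> \<open>by monotonicity the eigenvalues lie between the last one and 0\<close>
      have anti: "\<nu> n j \<le> \<nu> n i" if "i \<le> j" for i j
      proof -
        have "\<not> \<nu> n i < \<nu> n j"
          using that elim Krawtchouk_eigenvalue_less_iff[of "q n" "p n" i j] by (simp add: \<nu>_def)
        then show ?thesis by simp
      qed
      have "\<nu> n 0 = 0" by (simp add: \<nu>_def Krawtchouk_eigenvalue_def)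
      show ?case
      proof (intro allI impI)
        fix j assume "j \<le> N n"
        then have "\<nu> n (N n) \<le> \<nu> n j" "\<nu> n j \<le> 0"
          using anti[of j "N n"] anti[of 0 j] \<open>\<nu> n 0 = 0\<close> by simp_all
        then show "\<bar>\<nu> n j\<bar> \<le> \<bar>ev (c + 1)\<bar> + 1"
          using elim(2) unfolding dist_real_def by linarith
      qed
    qed
    show "(\<lambda>n. a n u) \<longlonglongrightarrow> \<alpha>" for u
    proof -
      have "(\<lambda>n. real (x n u) / real n + 1 / real n) \<longlonglongrightarrow> t + 0"
        by (intro tendsto_intros x_ratio lim_const_over_n)
      then have "(\<lambda>n. real (x n u + 1) / real n) \<longlonglongrightarrow> t"
        by (simp add: add_divide_distrib add.commute)
      then show ?thesis
        unfolding a_def Jacobi_entry_def BD[symmetric]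
        by (intro tendsto_intros birth_lim death_lim x_ratio)
    qed
    show "(\<lambda>n. b n u) \<longlonglongrightarrow> - (B + D)" for u
      unfolding b_def by (intro tendsto_intros birth_lim death_lim x_ratio)
    show "0 < \<alpha>" using S by (simp add: \<alpha>_def)
  qed
  have "(\<lambda>n. real n / real n) \<longlonglongrightarrow> 1"
    by (rule tendsto_eventually) (use eventually_gt_at_top[of 0] in eventually_elim, simp)
  then have "(\<lambda>n. \<nu> n n) \<longlonglongrightarrow> ev 1" by (rule ev_lim)
  from spectral_projection_limit[OF this C[unfolded C_eq], of u v]
  have "(\<lambda>n. \<Sum>j | j \<le> N n \<and> \<nu> n n < \<nu> n j. \<psi> n j u * \<psi> n j v) \<longlonglongrightarrow> discrete_sine_kernel (arccos C) u v"
    unfolding C_eq .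
  then show ?thesis
  proof (rule Lim_transform_eventually)
    show "\<forall>\<^sub>F n in sequentially. (\<Sum>j | j \<le> N n \<and> \<nu> n n < \<nu> n j. \<psi> n j u * \<psi> n j v)
        = q_Krawtchouk_kernel (q n) (P n) (W n) n (nat (\<lfloor>real n * t\<rfloor> + u)) (nat (\<lfloor>real n * t\<rfloor> + v))"
      using ok
    proof eventually_elim
      case (elim n)
      have iff: "\<nu> n n < \<nu> n j \<longleftrightarrow> j < n" for j
        unfolding \<nu>_def using elim by (intro Krawtchouk_eigenvalue_less_iff) blast+
      have "n \<le> N n" using elim by blast
      then have "j \<le> N n \<and> \<nu> n n < \<nu> n j \<longleftrightarrow> j < n" for j
        unfolding iff by (metis less_imp_le order_trans)
      then have "{j. j \<le> N n \<and> \<nu> n n < \<nu> n j} = {..<n}"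
        by (simp only: lessThan_def)
      moreover have "W n = Krawtchouk_weight (q n) (p n) (N n)"
        using elim by blast
      ultimately show ?case
        unfolding q_Krawtchouk_kernel_def \<psi>_def Krawtchouk_function_def x_def real_sqrt_mult sum_distrib_left
        by (simp add: mult_ac)
    qed
  qed
qed

theorem theorem2:
  fixes c \<gamma> t :: real and k :: "nat \<Rightarrow> nat" and q :: "nat \<Rightarrow> real" and u v :: int
  assumes "0 < c" and "\<gamma> \<noteq> 0"
    and "filterlim k at_top sequentially"
    and "(\<lambda>n. real (k n) / real n) \<longlonglongrightarrow> c"
    and "\<And>n. 1 \<le> n \<Longrightarrow> q n = 1 - \<gamma> / real n"
    and "0 < t" and "t < c + 1"
  shows
    "(\<forall>P. (\<forall>\<^sub>F n in sequentially.
              normalized_q_Krawtchouk (q n) (p_A (q n) n (k n)) (n + k n - 1) (P n)) \<longrightarrow>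
          cos_phi_A \<gamma> c t \<in> {-1..1} \<longrightarrow>
          (\<lambda>n. q_Krawtchouk_kernel (q n) (P n) (W_A (q n) n (k n)) n
                 (nat (\<lfloor>real n * t\<rfloor> + u)) (nat (\<lfloor>real n * t\<rfloor> + v)))
            \<longlonglongrightarrow> discrete_sine_kernel (arccos (cos_phi_A \<gamma> c t)) u v) \<and>
     (\<forall>P. (\<forall>\<^sub>F n in sequentially.
              normalized_q_Krawtchouk (q n) (p_B (q n) n (k n)) (n + k n - 1) (P n)) \<longrightarrow>
          cos_phi_B \<gamma> c t \<in> {-1..1} \<longrightarrow>
          (\<lambda>n. q_Krawtchouk_kernel (q n) (P n) (W_B (q n) n (k n)) n
                 (nat (\<lfloor>real n * t\<rfloor> + u)) (nat (\<lfloor>real n * t\<rfloor> + v)))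
            \<longlonglongrightarrow> discrete_sine_kernel (arccos (cos_phi_B \<gamma> c t)) u v)"
proof -
  have q: "\<forall>n\<ge>1. q n = 1 - \<gamma> / real n"
    using assms(5) by blast
  let ?S = "sqrt ((1 - exp (\<gamma> * t)) * (1 - exp (\<gamma> * (c + 1 - t))))"
  note limit = q_Krawtchouk_sine_limit[where q = q and \<gamma> = \<gamma> and c = c and t = t and k = k, OF assms(2-4) q assms(6,7)]
  have "(\<lambda>n. 1 - \<gamma> / real n) \<longlonglongrightarrow> 1 - 0"
    by (intro tendsto_intros lim_const_over_n)
  then have "\<forall>\<^sub>F n in sequentially. 0 < 1 - \<gamma> / real n"
    by (rule order_tendstoD) simp
  then have q_pos: "\<forall>\<^sub>F n in sequentially. 0 < q n"
    using eventually_ge_at_top[of 1] by eventually_elim (simp add: assms(5))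
  have powi_merge: "(q powi m) powi (- int i) * q powi l = q powi (l - m * int i)"
    if "0 < q" for q :: real and m l i
    using that by (simp add: power_int_mult[symmetric] power_int_add[symmetric])
  have cancel: "s * (e * z) / (2 * (h * S)) = s * (d / 2) * (z / S)" if "e = d * h" "h \<noteq> 0"
    for s e z h S d :: real
    using that by (simp add: divide_simps)
  have "(\<lambda>n. q_Krawtchouk_kernel (q n) (P n) (W_A (q n) n (k n)) n
          (nat (\<lfloor>real n * t\<rfloor> + u)) (nat (\<lfloor>real n * t\<rfloor> + v)))
        \<longlonglongrightarrow> discrete_sine_kernel (arccos (cos_phi_A \<gamma> c t)) u v"
    if P: "\<forall>\<^sub>F n in sequentially. normalized_q_Krawtchouk (q n) (p_A (q n) n (k n)) (n + k n - 1) (P n)"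
      and C: "cos_phi_A \<gamma> c t \<in> {-1..1}" for P
  proof -
    have numer: "exp \<gamma> - exp (2 * \<gamma> - \<gamma>) - exp (\<gamma> * (c + 1 - t)) + exp (2 * \<gamma> - \<gamma> * t)
        = exp (2 * \<gamma> - \<gamma> * t) * (1 - exp (\<gamma> * (c - 1)))"
      by (simp add: right_diff_distrib exp_add[symmetric]) (simp add: algebra_simps)
    have denom: "exp (2 * \<gamma> - \<gamma> * t) = exp (\<gamma> - \<gamma> * t / 2) * exp ((2 * \<gamma> - \<gamma> * t) / 2)"
      by (simp add: exp_add[symmetric] field_simps)
    have cos_eq: "sgn (- \<gamma>) * (exp \<gamma> - exp (2 * \<gamma> - \<gamma>) - exp (\<gamma> * (c + 1 - t)) + exp (2 * \<gamma> - \<gamma> * t))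
        / (2 * (exp ((2 * \<gamma> - \<gamma> * t) / 2) * ?S)) = cos_phi_A \<gamma> c t"
      unfolding cos_phi_A_def by (simp only: numer cancel[OF denom exp_not_eq_zero])
    have "(\<lambda>n. 1 / real n - 2) \<longlonglongrightarrow> 0 - 2"
      by (intro tendsto_intros lim_const_over_n)
    then have "(\<lambda>n. of_int (1 - 2 * int n) / real n) \<longlonglongrightarrow> - 2"
      by (rule Lim_transform_eventually[OF _ eventually_mono[OF eventually_gt_at_top[of 0]], THEN tendsto_eq_rhs])
        (auto simp: field_simps)
    from power_int_exp_limit[where q = q and \<gamma> = \<gamma>, OF q this]
    have p_lim: "(\<lambda>n. p_A (q n) n (k n)) \<longlonglongrightarrow> exp (2 * \<gamma>)"
      by (simp add: p_A_def mult.commute)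
    have p_pos: "\<forall>\<^sub>F n in sequentially. 0 < p_A (q n) n (k n)"
      using q_pos by eventually_elim (simp add: p_A_def)
    have W: "\<forall>\<^sub>F n in sequentially. W_A (q n) n (k n)
        = Krawtchouk_weight (q n) (p_A (q n) n (k n)) (n + k n - 1)"
      using q_pos eventually_ge_at_top[of 1]
    proof eventually_elim
      case (elim n)
      show ?case
      proof
        fix a
        have "int (a choose 2) + int a * (int n - int (k n))
            = int (a choose 2) - int a * int (n + k n - 1) - (1 - 2 * int n) * int a"
          using elim by (simp add: of_nat_diff algebra_simps)
        then have "q n powi (int (a choose 2) + int a * (int n - int (k n)))
            = (q n powi (1 - 2 * int n)) powi (- int a) * q n powi (int (a choose 2) - int a * int (n + k n - 1))"
          by (simp only: powi_merge[OF elim(1)])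
        then show "W_A (q n) n (k n) a = Krawtchouk_weight (q n) (p_A (q n) n (k n)) (n + k n - 1) a"
          unfolding W_A_def Krawtchouk_weight_def p_A_def by (simp only: mult_ac)
      qed
    qed
    show ?thesis
      using limit[OF p_pos p_lim W P] C unfolding cos_eq by blast
  qed
  moreover have "(\<lambda>n. q_Krawtchouk_kernel (q n) (P n) (W_B (q n) n (k n)) n
          (nat (\<lfloor>real n * t\<rfloor> + u)) (nat (\<lfloor>real n * t\<rfloor> + v)))
        \<longlonglongrightarrow> discrete_sine_kernel (arccos (cos_phi_B \<gamma> c t)) u v"
    if P: "\<forall>\<^sub>F n in sequentially. normalized_q_Krawtchouk (q n) (p_B (q n) n (k n)) (n + k n - 1) (P n)"
      and C: "cos_phi_B \<gamma> c t \<in> {-1..1}" for P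
  proof -
    define g where "g = \<gamma> * (2 + c)"
    have numer: "exp \<gamma> - exp (g - \<gamma>) - exp (\<gamma> * (c + 1 - t)) + exp (g - \<gamma> * t)
        = exp \<gamma> * (1 - exp (\<gamma> * c) - exp (\<gamma> * (c - t)) + exp (\<gamma> * (c + 1 - t)))"
      unfolding g_def by (simp add: distrib_left right_diff_distrib exp_add[symmetric]) (simp add: algebra_simps)
    have denom: "exp \<gamma> = exp (\<gamma> / 2 * (t - c)) * exp ((g - \<gamma> * t) / 2)"
      unfolding g_def by (simp add: exp_add[symmetric] field_simps)
    have cos_eq: "sgn (- \<gamma>) * (exp \<gamma> - exp (g - \<gamma>) - exp (\<gamma> * (c + 1 - t)) + exp (g - \<gamma> * t))
        / (2 * (exp ((g - \<gamma> * t) / 2) * ?S)) = cos_phi_B \<gamma> c t"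
      unfolding cos_phi_B_def by (simp only: numer cancel[OF denom exp_not_eq_zero])
    have "(\<lambda>n. 2 / real n - 2 - real (k n) / real n) \<longlonglongrightarrow> 0 - 2 - c"
      by (intro tendsto_intros lim_const_over_n assms(4))
    then have "(\<lambda>n. of_int (2 - 2 * int n - int (k n)) / real n) \<longlonglongrightarrow> - (2 + c)"
      by (rule Lim_transform_eventually[OF _ eventually_mono[OF eventually_gt_at_top[of 0]], THEN tendsto_eq_rhs])
        (auto simp: field_simps)
    from power_int_exp_limit[where q = q and \<gamma> = \<gamma>, OF q this]
    have p_lim: "(\<lambda>n. p_B (q n) n (k n)) \<longlonglongrightarrow> exp g"
      by (simp add: p_B_def g_def algebra_simps)
    have p_pos: "\<forall>\<^sub>F n in sequentially. 0 < p_B (q n) n (k n)"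
      using q_pos by eventually_elim (simp add: p_B_def)
    have W: "\<forall>\<^sub>F n in sequentially. W_B (q n) n (k n)
        = Krawtchouk_weight (q n) (p_B (q n) n (k n)) (n + k n - 1)"
      using q_pos eventually_ge_at_top[of 1]
    proof eventually_elim
      case (elim n)
      show ?case
      proof
        fix a
        have "int (a choose 2) + int a * (int n - 1)
            = int (a choose 2) - int a * int (n + k n - 1) - (2 - 2 * int n - int (k n)) * int a"
          using elim by (simp add: of_nat_diff algebra_simps)
        then have "q n powi (int (a choose 2) + int a * (int n - 1))
            = (q n powi (2 - 2 * int n - int (k n))) powi (- int a) * q n powi (int (a choose 2) - int a * int (n + k n - 1))"
          by (simp only: powi_merge[OF elim(1)])
        then show "W_B (q n) n (k n) a = Krawtchouk_weight (q n) (p_B (q n) n (k n)) (n + k n - 1) a"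
          unfolding W_B_def Krawtchouk_weight_def p_B_def by (simp only: mult_ac)
      qed
    qed
    show ?thesis
      using limit[of "\<lambda>n. p_B (q n) n (k n)" g, OF _ p_lim W P] q_pos C
      unfolding cos_eq by (simp add: p_B_def eventually_mono)
  qed
  ultimately show ?thesis by blast
qed

end
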